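(* Let $G$ be a group with identity element $e$ and let $R=\oplus_{g\in G}R_g$ be a strongly $G$-graded ring. The following three assertions are equivalent: (i) $R$ is $G$-controlled; (ii) $R_g$ is a simple $R_e$-bimodule, for every $g\in G$, and $C_R(R_e)=Z(R_e)$; (iii) $R_g$ is a simple $R_e$-bimodule, for every $g\in G$, and the group homomorphism $\psi:G\to \mathrm{Pic}(R_e)$, $g\mapsto [R_g]$, is injective.
   Context: Rings are associative and unital. For subsets $X,Y$ of a ring, $XY$ denotes the set of all finite sums of elements $xy$ with $x\in X$, $y\in Y$. A ring $R$ is $G$-graded if there are additive subgroups $R_g$ ($g\in G$) of $R$ with $R=\oplus_{g\in G}R_g$ and $R_gR_h\subseteq R_{gh}$ for all $g,h\in G$; it is strongly $G$-graded if moreover $R_gR_h=R_{gh}$ for all $g,h\in G$. Then $R_e$ is a subring of $R$ with $1_R\in R_e$, and each $R_g$ is an $R_e$-bimodule by multiplication in $R$. For $H\subseteq G$ put $R_H=\oplus_{h\in H}R_h$, with $R_\varnothing=\{0\}$; it is an $R_e$-bimodule. Simple bimodules are by definition non-zero. $C_R(R_e)$ is the set of elements of $R$ commuting with every element of $R_e$, and $Z(R_e)$ is the centre of $R_e$. The $G$-graded ring $R$ is called $G$-controlled if, for the given gradation: (1) the map $H\mapsto R_H=\oplus_{h\in H}R_h$ from the power set of $G$ to the set of all $R_e$-bimodules contained in $R$ (with scalar multiplication coming from the multiplication of $R$) is a bijection; and (2) for $S,T\subseteq G$, $R_S\cong R_T$ as $R_e$-bimodules if and only if $S=T$. For a ring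 $T$, a $T$-bimodule $M$ is invertible if there is a $T$-bimodule $N$ with $M\otimes_T N\cong T$ and $N\otimes_T M\cong T$ as $T$-bimodules. The Picard group $\mathrm{Pic}(T)$ is the group of isomorphism classes $[M]$ of invertible $T$-bimodules under $\otimes_T$. For a strongly $G$-graded ring $R$ each $R_g$ is an invertible $R_e$-bimodule and $\psi:G\to\mathrm{Pic}(R_e)$, $g\mapsto[R_g]$, is a group homomorphism. *)

theory Defs
  imports "HOL-Algebra.Algebra"
begin

section \<open>Bimodules over a ring\<close>

text \<open>The record extends the library's module record by a right action; as there, the fields
  \<^term>\<open>monoid.mult\<close> and \<^term>\<open>monoid.one\<close> inherited from the ring record play no role.\<close>

record ('a, 'm) bimodule = "('a, 'm) module" +
  rsmult :: "['m, 'a] \<Rightarrow> 'm" (infixl \<open>\<odot>\<^sub>r\<index>\<close> 70)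

locale bimodule = T?: ring T + M?: abelian_group M
  for T :: "('a, 'c) ring_scheme" (structure) and M :: "('a, 'm, 'z) bimodule_scheme" (structure) +
  assumes smult_closed:
      "\<lbrakk>a \<in> carrier T; x \<in> carrier M\<rbrakk> \<Longrightarrow> a \<odot>\<^bsub>M\<^esub> x \<in> carrier M"
    and rsmult_closed:
      "\<lbrakk>a \<in> carrier T; x \<in> carrier M\<rbrakk> \<Longrightarrow> x \<odot>\<^sub>r\<^bsub>M\<^esub> a \<in> carrier M"
    and smult_l_distr:
      "\<lbrakk>a \<in> carrier T; b \<in> carrier T; x \<in> carrier M\<rbrakk> \<Longrightarrow>
        (a \<oplus>\<^bsub>T\<^esub> b) \<odot>\<^bsub>M\<^esub> x = a \<odot>\<^bsub>M\<^esub> x \<oplus>\<^bsub>M\<^esub> b \<odot>\<^bsub>M\<^esub> x"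
    and smult_r_distr:
      "\<lbrakk>a \<in> carrier T; x \<in> carrier M; y \<in> carrier M\<rbrakk> \<Longrightarrow>
        a \<odot>\<^bsub>M\<^esub> (x \<oplus>\<^bsub>M\<^esub> y) = a \<odot>\<^bsub>M\<^esub> x \<oplus>\<^bsub>M\<^esub> a \<odot>\<^bsub>M\<^esub> y"
    and rsmult_l_distr:
      "\<lbrakk>a \<in> carrier T; x \<in> carrier M; y \<in> carrier M\<rbrakk> \<Longrightarrow>
        (x \<oplus>\<^bsub>M\<^esub> y) \<odot>\<^sub>r\<^bsub>M\<^esub> a = x \<odot>\<^sub>r\<^bsub>M\<^esub> a \<oplus>\<^bsub>M\<^esub> y \<odot>\<^sub>r\<^bsub>M\<^esub> a"
    and rsmult_r_distr:
      "\<lbrakk>a \<in> carrier T; b \<in> carrier T; x \<in> carrier M\<rbrakk> \<Longrightarrow>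
        x \<odot>\<^sub>r\<^bsub>M\<^esub> (a \<oplus>\<^bsub>T\<^esub> b) = x \<odot>\<^sub>r\<^bsub>M\<^esub> a \<oplus>\<^bsub>M\<^esub> x \<odot>\<^sub>r\<^bsub>M\<^esub> b"
    and smult_assoc:
      "\<lbrakk>a \<in> carrier T; b \<in> carrier T; x \<in> carrier M\<rbrakk> \<Longrightarrow>
        (a \<otimes>\<^bsub>T\<^esub> b) \<odot>\<^bsub>M\<^esub> x = a \<odot>\<^bsub>M\<^esub> (b \<odot>\<^bsub>M\<^esub> x)"
    and rsmult_assoc:
      "\<lbrakk>a \<in> carrier T; b \<in> carrier T; x \<in> carrier M\<rbrakk> \<Longrightarrow>
        x \<odot>\<^sub>r\<^bsub>M\<^esub> (a \<otimes>\<^bsub>T\<^esub> b) = (x \<odot>\<^sub>r\<^bsub>M\<^esub> a) \<odot>\<^sub>r\<^bsub>M\<^esub> b"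
    and smult_rsmult_assoc:
      "\<lbrakk>a \<in> carrier T; b \<in> carrier T; x \<in> carrier M\<rbrakk> \<Longrightarrow>
        (a \<odot>\<^bsub>M\<^esub> x) \<odot>\<^sub>r\<^bsub>M\<^esub> b = a \<odot>\<^bsub>M\<^esub> (x \<odot>\<^sub>r\<^bsub>M\<^esub> b)"
    and smult_one: "x \<in> carrier M \<Longrightarrow> \<one>\<^bsub>T\<^esub> \<odot>\<^bsub>M\<^esub> x = x"
    and rsmult_one: "x \<in> carrier M \<Longrightarrow> x \<odot>\<^sub>r\<^bsub>M\<^esub> \<one>\<^bsub>T\<^esub> = x"

definition subbimodule ::
    "('a, 'c) ring_scheme \<Rightarrow> 'm set \<Rightarrow> ('a, 'm, 'z) bimodule_scheme \<Rightarrow> bool"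
  where "subbimodule T N M \<longleftrightarrow> N \<subseteq> carrier M \<and> bimodule T (M\<lparr>carrier := N\<rparr>)"

definition simple_bimodule ::
    "('a, 'c) ring_scheme \<Rightarrow> ('a, 'm, 'z) bimodule_scheme \<Rightarrow> bool"
  where "simple_bimodule T M \<longleftrightarrow>
    bimodule T M \<and> carrier M \<noteq> {\<zero>\<^bsub>M\<^esub>} \<and>
    (\<forall>N. subbimodule T N M \<longrightarrow> N = {\<zero>\<^bsub>M\<^esub>} \<or> N = carrier M)"

definition bimodule_isomorphic ::
    "('a, 'c) ring_scheme \<Rightarrow> ('a, 'm, 'z) bimodule_scheme \<Rightarrow> ('a, 'n, 'y) bimodule_scheme \<Rightarrow> bool"
  where "bimodule_isomorphic T M N \<longleftrightarrow>
    (\<exists>f \<in> iso (add_monoid M) (add_monoid N).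
      \<forall>a \<in> carrier T. \<forall>x \<in> carrier M.
        f (a \<odot>\<^bsub>M\<^esub> x) = a \<odot>\<^bsub>N\<^esub> f x \<and> f (x \<odot>\<^sub>r\<^bsub>M\<^esub> a) = f x \<odot>\<^sub>r\<^bsub>N\<^esub> a)"

text \<open>A ring acting on itself by left and right multiplication. \<open>bimodule_in R S\<close> is the subset \<open>S\<close>
  of \<open>R\<close> with the operations of \<open>R\<close>, to be considered over a subring of \<open>R\<close>.\<close>

definition ring_bimodule :: "('a, 'c) ring_scheme \<Rightarrow> ('a, 'a) bimodule"
  where "ring_bimodule R =
    \<lparr>carrier = carrier R, monoid.mult = monoid.mult R, monoid.one = monoid.one R,
     ring.zero = ring.zero R, ring.add = ring.add R, smult = monoid.mult R, rsmult = monoid.mult R\<rparr>"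

definition bimodule_in :: "('r, 'c) ring_scheme \<Rightarrow> 'r set \<Rightarrow> ('r, 'r) bimodule"
  where "bimodule_in R S = (ring_bimodule R)\<lparr>carrier := S\<rparr>"


section \<open>Tensor products and the Picard group\<close>

text \<open>The tensor product is the quotient of the free abelian group on
  \<open>carrier M \<times> carrier N\<close> by the subgroup generated by the biadditivity and
  balancing relations.\<close>

definition tensor_group ::
    "('a, 'm, 'z) bimodule_scheme \<Rightarrow> ('a, 'n, 'y) bimodule_scheme \<Rightarrow> ('m \<times> 'n \<Rightarrow>\<^sub>0 int) monoid"
  where "tensor_group M N = free_Abelian_group (carrier M \<times> carrier N)"

definition tensor_relations ::
    "('a, 'c) ring_scheme \<Rightarrow> ('a, 'm, 'z) bimodule_scheme \<Rightarrow> ('a, 'n, 'y) bimodule_scheme \<Rightarrow>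
      ('m \<times> 'n \<Rightarrow>\<^sub>0 int) set"
  where "tensor_relations T M N = generate (tensor_group M N)
    ({frag_of (x \<oplus>\<^bsub>M\<^esub> x', y) - frag_of (x, y) - frag_of (x', y) | x x' y.
        x \<in> carrier M \<and> x' \<in> carrier M \<and> y \<in> carrier N} \<union>
     {frag_of (x, y \<oplus>\<^bsub>N\<^esub> y') - frag_of (x, y) - frag_of (x, y') | x y y'.
        x \<in> carrier M \<and> y \<in> carrier N \<and> y' \<in> carrier N} \<union>
     {frag_of (x \<odot>\<^sub>r\<^bsub>M\<^esub> a, y) - frag_of (x, a \<odot>\<^bsub>N\<^esub> y) | a x y.
        a \<in> carrier T \<and> x \<in> carrier M \<and> y \<in> carrier N})"

text \<open>The actions are \<open>a (x \<otimes> y) = (a x) \<otimes> y\<close> and \<open>(x \<otimes> y) a = x \<otimes> (y a)\<close>, extended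
  additively to the free abelian group and applied to (all representatives of) a coset.\<close>

definition tensor ::
    "('a, 'c) ring_scheme \<Rightarrow> ('a, 'm, 'z) bimodule_scheme \<Rightarrow> ('a, 'n, 'y) bimodule_scheme \<Rightarrow>
      ('a, ('m \<times> 'n \<Rightarrow>\<^sub>0 int) set) bimodule"
  where "tensor T M N =
    (let F = tensor_group M N; K = tensor_relations T M N in
     \<lparr>carrier = carrier (F Mod K), monoid.mult = undefined, monoid.one = undefined,
      ring.zero = monoid.one (F Mod K), ring.add = monoid.mult (F Mod K),
      smult = (\<lambda>a P. \<Union>c\<in>P. K #>\<^bsub>F\<^esub> frag_extend (\<lambda>(x, y). frag_of (a \<odot>\<^bsub>M\<^esub> x, y)) c),
      rsmult = (\<lambda>P a. \<Union>c\<in>P. K #>\<^bsub>F\<^esub> frag_extend (\<lambda>(x, y). frag_of (x, y \<odot>\<^sub>r\<^bsub>N\<^esub> a)) c)\<rparr>)"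

text \<open>HOL has no collection of all \<open>T\<close>-bimodules across all types, so isomorphism classes are
  formed among bimodules whose elements are lists over the type of \<open>T\<close>. No invertible bimodule is
  lost: if \<open>M\<close> is invertible then it is finitely generated as a left \<open>T\<close>-module, hence every
  element of \<open>M\<close> is determined by a list of coefficients and \<open>M\<close> has an isomorphic copy on this
  type. The same applies to the inverse bimodule in the definition of invertibility, which is
  itself invertible. The bimodule \<open>M\<close> whose class is taken may live on any type.\<close>

definition invertible_bimodule ::
    "('a, 'c) ring_scheme \<Rightarrow> ('a, 'm, 'z) bimodule_scheme \<Rightarrow> bool"
  where "invertible_bimodule T M \<longleftrightarrow>
    bimodule T M \<and>
    (\<exists>N :: ('a, 'a list) bimodule. bimodule T N \<and>
      bimodule_isomorphic T (tensor T M N) (ring_bimodule T) \<and>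
      bimodule_isomorphic T (tensor T N M) (ring_bimodule T))"

definition bimodule_class ::
    "('a, 'c) ring_scheme \<Rightarrow> ('a, 'm, 'z) bimodule_scheme \<Rightarrow> ('a, 'a list) bimodule set"
  where "bimodule_class T M = {N. bimodule T N \<and> bimodule_isomorphic T N M}"

definition Pic :: "('a, 'c) ring_scheme \<Rightarrow> ('a, 'a list) bimodule set monoid"
  where "Pic T =
    \<lparr>carrier = {bimodule_class T M | M :: ('a, 'a list) bimodule. invertible_bimodule T M},
     monoid.mult = (\<lambda>P Q. \<Union>M\<in>P. \<Union>N\<in>Q. bimodule_class T (tensor T M N)),
     monoid.one = bimodule_class T (ring_bimodule T)\<rparr>"


section \<open>Graded rings\<close>

definition set_prod :: "('r, 'c) ring_scheme \<Rightarrow> 'r set \<Rightarrow> 'r set \<Rightarrow> 'r set"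
  where "set_prod R P Q =
    {\<Oplus>\<^bsub>R\<^esub>i\<in>{..<n}. x i \<otimes>\<^bsub>R\<^esub> y i | (n :: nat) x y. x \<in> {..<n} \<rightarrow> P \<and> y \<in> {..<n} \<rightarrow> Q}"

text \<open>The gradation is a family \<open>A\<close> of subsets of \<open>R\<close>; only its values on \<open>carrier G\<close> matter.\<close>

locale graded_ring = G?: group G + R?: ring R
  for G (structure) and R (structure) and A +
  assumes component_additive_subgroup: "g \<in> carrier G \<Longrightarrow> additive_subgroup (A g) R"
    and direct_sum: "x \<in> carrier R \<Longrightarrow>
      \<exists>!f. f \<in> (\<Pi>\<^sub>E g\<in>carrier G. A g) \<and> finite {g \<in> carrier G. f g \<noteq> \<zero>\<^bsub>R\<^esub>} \<and>
        x = (\<Oplus>\<^bsub>R\<^esub>g\<in>{g \<in> carrier G. f g \<noteq> \<zero>\<^bsub>R\<^esub>}. f g)"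
    and component_mult: "\<lbrakk>g \<in> carrier G; h \<in> carrier G\<rbrakk> \<Longrightarrow>
      set_prod R (A g) (A h) \<subseteq> A (g \<otimes>\<^bsub>G\<^esub> h)"

locale strongly_graded_ring = graded_ring +
  assumes component_mult_eq: "\<lbrakk>g \<in> carrier G; h \<in> carrier G\<rbrakk> \<Longrightarrow>
      set_prod R (A g) (A h) = A (g \<otimes>\<^bsub>G\<^esub> h)"

definition identity_component ::
    "('g, 'b) monoid_scheme \<Rightarrow> ('r, 'c) ring_scheme \<Rightarrow> ('g \<Rightarrow> 'r set) \<Rightarrow> ('r, 'c) ring_scheme"
  where "identity_component G R A = R\<lparr>carrier := A \<one>\<^bsub>G\<^esub>\<rparr>"

text \<open>The set \<open>R\<^sub>H\<close>, the sum of the components \<open>A h\<close> for \<open>h \<in> H\<close>; it is \<open>{\<zero>}\<close> for empty \<open>H\<close>.\<close>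

definition graded_part :: "('r, 'c) ring_scheme \<Rightarrow> ('g \<Rightarrow> 'r set) \<Rightarrow> 'g set \<Rightarrow> 'r set"
  where "graded_part R A H =
    {\<Oplus>\<^bsub>R\<^esub>h\<in>F. f h | F f. finite F \<and> F \<subseteq> H \<and> f \<in> (\<Pi> h\<in>F. A h)}"

definition controlled ::
    "('g, 'b) monoid_scheme \<Rightarrow> ('r, 'c) ring_scheme \<Rightarrow> ('g \<Rightarrow> 'r set) \<Rightarrow> bool"
  where "controlled G R A \<longleftrightarrow>
    bij_betw (graded_part R A) (Pow (carrier G))
      {M. subbimodule (identity_component G R A) M (ring_bimodule R)} \<and>
    (\<forall>S \<subseteq> carrier G. \<forall>T \<subseteq> carrier G.
      bimodule_isomorphic (identity_component G R A)
        (bimodule_in R (graded_part R A S))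
        (bimodule_in R (graded_part R A T)) \<longleftrightarrow> S = T)"

definition Pic_map ::
    "('g, 'b) monoid_scheme \<Rightarrow> ('r, 'c) ring_scheme \<Rightarrow> ('g \<Rightarrow> 'r set) \<Rightarrow>
      'g \<Rightarrow> ('r, 'r list) bimodule set"
  where "Pic_map G R A g =
    bimodule_class (identity_component G R A) (bimodule_in R (A g))"

definition centralizer :: "('r, 'c) ring_scheme \<Rightarrow> 'r set \<Rightarrow> 'r set"
  where "centralizer R S = {x \<in> carrier R. \<forall>s \<in> S. x \<otimes>\<^bsub>R\<^esub> s = s \<otimes>\<^bsub>R\<^esub> x}"

definition center :: "('r, 'c) ring_scheme \<Rightarrow> 'r set"
  where "center R = centralizer R (carrier R)"

end

theory Submission
  imports Defs
begin

text \<open>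
  Call the components pairwise non-isomorphic if \<open>A g \<cong> A h\<close>, as bimodules over the identity
  component, only for \<open>g = h\<close>. Each of the three assertions is equivalent to this: the components are
  simple and pairwise non-isomorphic.

  For control by the group, one direction evaluates the correspondence \<open>H \<mapsto> R\<^sub>H\<close> on singletons
  and on the empty set. Conversely, a direct sum of pairwise non-isomorphic simple bimodules has
  no subbimodules other than its partial sums (\<open>components_subset_of_stable\<close>), and partial sums over
  different sets are not isomorphic (\<open>isomorphic_graded_parts_subset\<close>). Both facts rest on Schur's
  lemma.

  For the centralizer, a homogeneous element \<open>c \<noteq> 0\<close> of degree \<open>g\<close> that commutes with the identity
  component yields, by multiplication, a nonzero homomorphism from \<open>A \<one>\<close> to \<open>A g\<close>
  (\<open>centralizer_eq_center\<close>). Conversely, strong gradation shows that an isomorphism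
  from \<open>A g\<close> to \<open>A h\<close> is multiplication by such an element of degree \<open>g\<inverse>h\<close>
  (\<open>isomorphic_components_eq\<close>).

  For the Picard group, multiplication in \<open>R\<close> gives \<open>A g \<otimes> A h \<cong> A (g h)\<close> (\<open>tensor_components\<close>).
  Hence \<open>g \<mapsto> [A g]\<close> takes values in invertible classes and is a homomorphism for every strongly
  graded ring, and its injectivity says that the components are pairwise non-isomorphic.
\<close>

section \<open>Homomorphisms and isomorphism classes of bimodules\<close>

definition bimodule_hom ::
    "('a, 'c) ring_scheme \<Rightarrow> ('a, 'm, 'z) bimodule_scheme \<Rightarrow> ('a, 'n, 'y) bimodule_scheme \<Rightarrow>
      ('m \<Rightarrow> 'n) set"
  where "bimodule_hom T M N = {f \<in> carrier M \<rightarrow> carrier N.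
    (\<forall>x \<in> carrier M. \<forall>y \<in> carrier M. f (x \<oplus>\<^bsub>M\<^esub> y) = f x \<oplus>\<^bsub>N\<^esub> f y) \<and>
    (\<forall>a \<in> carrier T. \<forall>x \<in> carrier M.
        f (a \<odot>\<^bsub>M\<^esub> x) = a \<odot>\<^bsub>N\<^esub> f x \<and> f (x \<odot>\<^sub>r\<^bsub>M\<^esub> a) = f x \<odot>\<^sub>r\<^bsub>N\<^esub> a)}"

lemma bimodule_homI:
  assumes "\<And>x. x \<in> carrier M \<Longrightarrow> f x \<in> carrier N"
    and "\<And>x y. \<lbrakk>x \<in> carrier M; y \<in> carrier M\<rbrakk> \<Longrightarrow> f (x \<oplus>\<^bsub>M\<^esub> y) = f x \<oplus>\<^bsub>N\<^esub> f y"
    and "\<And>a x. \<lbrakk>a \<in> carrier T; x \<in> carrier M\<rbrakk> \<Longrightarrow> f (a \<odot>\<^bsub>M\<^esub> x) = a \<odot>\<^bsub>N\<^esub> f x"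
    and "\<And>a x. \<lbrakk>a \<in> carrier T; x \<in> carrier M\<rbrakk> \<Longrightarrow> f (x \<odot>\<^sub>r\<^bsub>M\<^esub> a) = f x \<odot>\<^sub>r\<^bsub>N\<^esub> a"
  shows "f \<in> bimodule_hom T M N"
  using assms by (auto simp: bimodule_hom_def)

lemma bimodule_homD:
  assumes "f \<in> bimodule_hom T M N"
  shows "x \<in> carrier M \<Longrightarrow> f x \<in> carrier N"
    and "\<lbrakk>x \<in> carrier M; y \<in> carrier M\<rbrakk> \<Longrightarrow> f (x \<oplus>\<^bsub>M\<^esub> y) = f x \<oplus>\<^bsub>N\<^esub> f y"
    and "\<lbrakk>a \<in> carrier T; x \<in> carrier M\<rbrakk> \<Longrightarrow> f (a \<odot>\<^bsub>M\<^esub> x) = a \<odot>\<^bsub>N\<^esub> f x"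
    and "\<lbrakk>a \<in> carrier T; x \<in> carrier M\<rbrakk> \<Longrightarrow> f (x \<odot>\<^sub>r\<^bsub>M\<^esub> a) = f x \<odot>\<^sub>r\<^bsub>N\<^esub> a"
  using assms by (auto simp: bimodule_hom_def)

lemma bimodule_isomorphic_iff:
  "bimodule_isomorphic T M N \<longleftrightarrow> (\<exists>f \<in> bimodule_hom T M N. bij_betw f (carrier M) (carrier N))"
  by (auto simp: bimodule_isomorphic_def iso_def hom_def bimodule_hom_def)

lemma bimodule_hom_compose:
  "\<lbrakk>f \<in> bimodule_hom T M N; g \<in> bimodule_hom T N P\<rbrakk> \<Longrightarrow> g \<circ> f \<in> bimodule_hom T M P"
  by (auto simp: bimodule_hom_def Pi_iff)

text \<open>The hypotheses on \<open>M\<close> are the closure conditions alone, so that the lemma applies to a tensor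
  product before anything is known about the bimodule axioms there.\<close>

lemma bimodule_hom_inverse:
  assumes f: "f \<in> bimodule_hom T M N" and bij: "bij_betw f (carrier M) (carrier N)"
    and closed: "\<And>x y. \<lbrakk>x \<in> carrier M; y \<in> carrier M\<rbrakk> \<Longrightarrow> x \<oplus>\<^bsub>M\<^esub> y \<in> carrier M"
      "\<And>a x. \<lbrakk>a \<in> carrier T; x \<in> carrier M\<rbrakk> \<Longrightarrow> a \<odot>\<^bsub>M\<^esub> x \<in> carrier M"
      "\<And>a x. \<lbrakk>a \<in> carrier T; x \<in> carrier M\<rbrakk> \<Longrightarrow> x \<odot>\<^sub>r\<^bsub>M\<^esub> a \<in> carrier M"
  shows "inv_into (carrier M) f \<in> bimodule_hom T N M"
proof -
  let ?h = "inv_into (carrier M) f"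
  have h: "?h y \<in> carrier M" "f (?h y) = y" if "y \<in> carrier N" for y
    using bij that by (auto simp: bij_betw_def inv_into_into f_inv_into_f)
  have eq: "?h y = x" if "x \<in> carrier M" "f x = y" for x y
    using bij that by (auto simp: bij_betw_def)
  show ?thesis
    by (intro bimodule_homI eq) (simp_all add: h closed bimodule_homD[OF f])
qed

lemma bimodule_closed:
  assumes "bimodule T M"
  shows "\<lbrakk>x \<in> carrier M; y \<in> carrier M\<rbrakk> \<Longrightarrow> x \<oplus>\<^bsub>M\<^esub> y \<in> carrier M"
    and "\<lbrakk>a \<in> carrier T; x \<in> carrier M\<rbrakk> \<Longrightarrow> a \<odot>\<^bsub>M\<^esub> x \<in> carrier M"
    and "\<lbrakk>a \<in> carrier T; x \<in> carrier M\<rbrakk> \<Longrightarrow> x \<odot>\<^sub>r\<^bsub>M\<^esub> a \<in> carrier M"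
proof -
  interpret bimodule T M by fact
  show "\<lbrakk>x \<in> carrier M; y \<in> carrier M\<rbrakk> \<Longrightarrow> x \<oplus>\<^bsub>M\<^esub> y \<in> carrier M"
    by (rule M.a_closed)
  show "\<lbrakk>a \<in> carrier T; x \<in> carrier M\<rbrakk> \<Longrightarrow> a \<odot>\<^bsub>M\<^esub> x \<in> carrier M"
    by (rule smult_closed)
  show "\<lbrakk>a \<in> carrier T; x \<in> carrier M\<rbrakk> \<Longrightarrow> x \<odot>\<^sub>r\<^bsub>M\<^esub> a \<in> carrier M"
    by (rule rsmult_closed)
qed

lemma bimodule_isomorphic_refl: "bimodule_isomorphic T M M"
  unfolding bimodule_isomorphic_iff
  by (intro bexI[of _ "\<lambda>x. x"] bimodule_homI) (simp_all add: bij_betw_def)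

lemma bimodule_isomorphic_sym:
  assumes "bimodule T M" "bimodule_isomorphic T M N"
  shows "bimodule_isomorphic T N M"
proof -
  obtain f where f: "f \<in> bimodule_hom T M N" "bij_betw f (carrier M) (carrier N)"
    using assms(2) by (auto simp: bimodule_isomorphic_iff)
  have "inv_into (carrier M) f \<in> bimodule_hom T N M"
    by (intro bimodule_hom_inverse f bimodule_closed[OF assms(1)])
  then show ?thesis
    using bij_betw_inv_into[OF f(2)] by (auto simp: bimodule_isomorphic_iff)
qed

lemma bimodule_isomorphic_trans:
  "\<lbrakk>bimodule_isomorphic T M N; bimodule_isomorphic T N P\<rbrakk> \<Longrightarrow> bimodule_isomorphic T M P"
  unfolding bimodule_isomorphic_iff using bimodule_hom_compose bij_betw_trans by blast

lemma bimodule_class_eqI: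
  assumes "bimodule_isomorphic T M N" "bimodule_isomorphic T N M"
  shows "bimodule_class T M = bimodule_class T N"
  using assms unfolding bimodule_class_def by (auto intro: bimodule_isomorphic_trans)

text \<open>One-element lists serve as names for the elements of a bimodule that lives on the type of the
  scalars; this puts the components of a graded ring among the representatives from which
  isomorphism classes are formed.\<close>

lemma bimodule_list_copy:
  fixes M :: "('a, 'a) bimodule"
  assumes "bimodule T M"
  obtains L :: "('a, 'a list) bimodule" where "bimodule T L" "bimodule_isomorphic T L M"
proof
  interpret bimodule T M by fact
  define L :: "('a, 'a list) bimodule" where "L =
    \<lparr>carrier = (\<lambda>x. [x]) ` carrier M, monoid.mult = undefined, monoid.one = undefined,
      ring.zero = [\<zero>\<^bsub>M\<^esub>], ring.add = (\<lambda>x y. [hd x \<oplus>\<^bsub>M\<^esub> hd y]),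
      smult = (\<lambda>a x. [a \<odot>\<^bsub>M\<^esub> hd x]), rsmult = (\<lambda>x a. [hd x \<odot>\<^sub>r\<^bsub>M\<^esub> a])\<rparr>"
  have "abelian_group L"
    by (rule abelian_groupI)
       (auto simp: L_def M.a_ac intro: M.l_neg)
  then show "bimodule T L"
    by (intro bimodule.intro bimodule_axioms.intro T.ring_axioms)
       (auto simp: L_def smult_closed rsmult_closed smult_l_distr smult_r_distr rsmult_l_distr
         rsmult_r_distr smult_assoc rsmult_assoc smult_rsmult_assoc smult_one rsmult_one)
  show "bimodule_isomorphic T L M"
    unfolding bimodule_isomorphic_iff
    by (intro bexI[of _ hd] bimodule_homI) (auto simp: L_def bij_betw_def inj_on_def image_iff)
qed


section \<open>Homogeneous components\<close>

context graded_ring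
begin

abbreviation Re where "Re \<equiv> identity_component G R A"

lemma component_closed:
  assumes "g \<in> carrier G"
  shows "A g \<subseteq> carrier R" "\<zero>\<^bsub>R\<^esub> \<in> A g"
    and "\<lbrakk>x \<in> A g; y \<in> A g\<rbrakk> \<Longrightarrow> x \<oplus>\<^bsub>R\<^esub> y \<in> A g"
    and "x \<in> A g \<Longrightarrow> \<ominus>\<^bsub>R\<^esub> x \<in> A g"
proof -
  interpret additive_subgroup "A g" R
    using component_additive_subgroup[OF assms] .
  show "A g \<subseteq> carrier R" "\<zero>\<^bsub>R\<^esub> \<in> A g" "\<lbrakk>x \<in> A g; y \<in> A g\<rbrakk> \<Longrightarrow> x \<oplus>\<^bsub>R\<^esub> y \<in> A g"
    by (auto simp: a_subset)
  show "\<ominus>\<^bsub>R\<^esub> x \<in> A g" if "x \<in> A g"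
    using that by (rule a_inv_closed)
qed

lemma component_in_carrier: "\<lbrakk>g \<in> carrier G; x \<in> A g\<rbrakk> \<Longrightarrow> x \<in> carrier R"
  using component_closed(1) by blast

lemma component_mult_closed:
  assumes "g \<in> carrier G" "h \<in> carrier G" "x \<in> A g" "y \<in> A h"
  shows "x \<otimes>\<^bsub>R\<^esub> y \<in> A (g \<otimes> h)"
proof -
  have "x \<otimes>\<^bsub>R\<^esub> y = (\<Oplus>\<^bsub>R\<^esub>i\<in>{..<(1::nat)}. x \<otimes>\<^bsub>R\<^esub> y)"
    using assms by (simp add: component_in_carrier R.finsum_insert lessThan_Suc)
  with assms have "x \<otimes>\<^bsub>R\<^esub> y \<in> set_prod R (A g) (A h)"
    unfolding set_prod_def
    by (intro CollectI exI[of _ "1::nat"] exI[of _ "\<lambda>_. x"] exI[of _ "\<lambda>_. y"]) simp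
  with component_mult assms show ?thesis
    by blast
qed

definition components :: "'c \<Rightarrow> 'a \<Rightarrow> 'c"
  where "components x = (THE f. f \<in> (\<Pi>\<^sub>E g\<in>carrier G. A g) \<and>
    finite {g \<in> carrier G. f g \<noteq> \<zero>\<^bsub>R\<^esub>} \<and>
    x = (\<Oplus>\<^bsub>R\<^esub>g\<in>{g \<in> carrier G. f g \<noteq> \<zero>\<^bsub>R\<^esub>}. f g))"

abbreviation proj :: "'a \<Rightarrow> 'c \<Rightarrow> 'c"
  where "proj g x \<equiv> components x g"

definition supp :: "'c \<Rightarrow> 'a set"
  where "supp x = {g \<in> carrier G. proj g x \<noteq> \<zero>\<^bsub>R\<^esub>}"

lemma
  assumes "x \<in> carrier R"
  shows proj_in: "g \<in> carrier G \<Longrightarrow> proj g x \<in> A g"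
    and finite_supp: "finite (supp x)"
    and sum_proj: "x = (\<Oplus>\<^bsub>R\<^esub>g\<in>supp x. proj g x)"
  using theI'[OF direct_sum[OF assms], folded components_def]
  unfolding supp_def by blast+

lemma proj_in_carrier: "\<lbrakk>g \<in> carrier G; x \<in> carrier R\<rbrakk> \<Longrightarrow> proj g x \<in> carrier R"
  using proj_in component_in_carrier by blast

lemma supp_subset: "supp x \<subseteq> carrier G"
  by (auto simp: supp_def)

text \<open>Uniqueness of the decomposition: every finite sum of homogeneous elements of distinct degrees
  exhibits its own components. All further properties of \<open>proj\<close> are read off from a suitable sum.\<close>

lemma proj_eqI:
  assumes "finite F" "F \<subseteq> carrier G" "\<And>h. h \<in> F \<Longrightarrow> f h \<in> A h"
    and x: "x = (\<Oplus>\<^bsub>R\<^esub>h\<in>F. f h)" and "g \<in> carrier G"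
  shows "proj g x = (if g \<in> F then f g else \<zero>\<^bsub>R\<^esub>)"
proof -
  define f' where "f' = (\<lambda>h\<in>carrier G. if h \<in> F then f h else \<zero>\<^bsub>R\<^esub>)"
  let ?S = "{h \<in> carrier G. f' h \<noteq> \<zero>\<^bsub>R\<^esub>}"
  have f: "f \<in> F \<rightarrow> carrier R"
    using assms component_in_carrier by blast
  have S: "?S \<subseteq> F" "\<And>h. h \<in> F - ?S \<Longrightarrow> f h = \<zero>\<^bsub>R\<^esub>" "\<And>h. h \<in> ?S \<Longrightarrow> f' h = f h"
    using assms(2) by (auto simp: f'_def split: if_splits)
  have xc: "x \<in> carrier R"
    unfolding x using f by (rule R.finsum_closed)
  have "(\<Oplus>\<^bsub>R\<^esub>h\<in>?S. f' h) = (\<Oplus>\<^bsub>R\<^esub>h\<in>F. f h)"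
    by (rule R.add.finprod_mono_neutral_cong_left[OF assms(1) S f])
  moreover have "f' \<in> (\<Pi>\<^sub>E h\<in>carrier G. A h)" "finite ?S"
    using assms S(1) by (auto simp: f'_def component_closed dest: finite_subset)
  ultimately have "components x = f'"
    unfolding components_def using x by (intro the1_equality[OF direct_sum[OF xc]]) simp
  then show ?thesis
    using assms(5) by (simp add: f'_def)
qed

lemma proj_homogeneous:
  assumes "g \<in> carrier G" "h \<in> carrier G" "x \<in> A h"
  shows "proj g x = (if g = h then x else \<zero>\<^bsub>R\<^esub>)"
proof -
  have "x = (\<Oplus>\<^bsub>R\<^esub>k\<in>{h}. x)"
    using assms by (simp add: component_in_carrier R.finsum_insert)
  from proj_eqI[OF _ _ _ this] show ?thesis
    using assms by auto
qed

lemma component_inter: "\<lbrakk>g \<in> carrier G; h \<in> carrier G; x \<in> A g; x \<in> A h; g \<noteq> h\<rbrakk> \<Longrightarrow> x = \<zero>\<^bsub>R\<^esub>"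
  using proj_homogeneous[of g g x] proj_homogeneous[of g h x] by simp

lemma sum_proj_superset:
  assumes "x \<in> carrier R" "finite F" "supp x \<subseteq> F" "F \<subseteq> carrier G"
  shows "x = (\<Oplus>\<^bsub>R\<^esub>g\<in>F. proj g x)"
proof -
  have "(\<Oplus>\<^bsub>R\<^esub>g\<in>supp x. proj g x) = (\<Oplus>\<^bsub>R\<^esub>g\<in>F. proj g x)"
    using assms
    by (intro R.add.finprod_mono_neutral_cong_left)
       (auto simp: supp_def intro: proj_in_carrier)
  with sum_proj[OF assms(1)] show ?thesis
    by simp
qed

lemma proj_zero: "g \<in> carrier G \<Longrightarrow> proj g \<zero>\<^bsub>R\<^esub> = \<zero>\<^bsub>R\<^esub>"
  using proj_homogeneous[of g g "\<zero>\<^bsub>R\<^esub>"] component_closed(2) by simp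

lemma supp_eq_empty:
  assumes "x \<in> carrier R"
  shows "supp x = {} \<longleftrightarrow> x = \<zero>\<^bsub>R\<^esub>"
proof
  show "x = \<zero>\<^bsub>R\<^esub>" if "supp x = {}"
    using sum_proj[OF assms] unfolding that by simp
qed (simp add: supp_def proj_zero)

lemma proj_add:
  assumes "g \<in> carrier G" "x \<in> carrier R" "y \<in> carrier R"
  shows "proj g (x \<oplus>\<^bsub>R\<^esub> y) = proj g x \<oplus>\<^bsub>R\<^esub> proj g y"
proof -
  let ?F = "supp x \<union> supp y"
  have F: "finite ?F" "?F \<subseteq> carrier G"
    using assms finite_supp supp_subset by auto
  have "x \<oplus>\<^bsub>R\<^esub> y = (\<Oplus>\<^bsub>R\<^esub>g\<in>?F. proj g x) \<oplus>\<^bsub>R\<^esub> (\<Oplus>\<^bsub>R\<^esub>g\<in>?F. proj g y)"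
    using sum_proj_superset[of x ?F] sum_proj_superset[of y ?F] F assms by auto
  also have "\<dots> = (\<Oplus>\<^bsub>R\<^esub>g\<in>?F. proj g x \<oplus>\<^bsub>R\<^esub> proj g y)"
    using assms F by (intro R.finsum_addf[symmetric]) (auto intro: proj_in_carrier)
  finally have "proj g (x \<oplus>\<^bsub>R\<^esub> y) = (if g \<in> ?F then proj g x \<oplus>\<^bsub>R\<^esub> proj g y else \<zero>\<^bsub>R\<^esub>)"
    using assms F by (intro proj_eqI[of ?F]) (auto intro!: component_closed(3) proj_in)
  then show ?thesis
    using assms by (auto simp: supp_def)
qed

lemma proj_minus:
  assumes "g \<in> carrier G" "x \<in> carrier R"
  shows "proj g (\<ominus>\<^bsub>R\<^esub> x) = \<ominus>\<^bsub>R\<^esub> proj g x"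
  using proj_add[of g "\<ominus>\<^bsub>R\<^esub> x" x] assms
  by (simp add: R.l_neg proj_zero proj_in_carrier R.minus_equality)

text \<open>A homogeneous factor of degree \<open>h\<close> on the left shifts all degrees by \<open>h\<close>. Only the case
  \<open>h = \<one>\<close> makes \<open>proj g\<close> linear over the identity component; the general case is what locates the
  unit of \<open>R\<close>.\<close>

lemma proj_mult_left:
  assumes "h \<in> carrier G" "g \<in> carrier G" "a \<in> A h" "x \<in> carrier R"
  shows "proj (h \<otimes> g) (a \<otimes>\<^bsub>R\<^esub> x) = a \<otimes>\<^bsub>R\<^esub> proj g x"
proof -
  let ?F = "(\<lambda>k. h \<otimes> k) ` supp x" and ?f = "\<lambda>k. a \<otimes>\<^bsub>R\<^esub> proj (inv h \<otimes> k) x"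
  have a: "a \<in> carrier R"
    using assms component_in_carrier by blast
  have inv: "inv h \<otimes> (h \<otimes> k) = k" if "k \<in> carrier G" for k
    using that assms by (simp flip: G.m_assoc)
  have "a \<otimes>\<^bsub>R\<^esub> x = a \<otimes>\<^bsub>R\<^esub> (\<Oplus>\<^bsub>R\<^esub>k\<in>supp x. proj k x)"
    using sum_proj assms by simp
  also have "\<dots> = (\<Oplus>\<^bsub>R\<^esub>k\<in>supp x. a \<otimes>\<^bsub>R\<^esub> proj k x)"
    using assms a supp_subset finite_supp by (intro R.finsum_rdistr) (auto intro!: proj_in_carrier)
  also have "\<dots> = (\<Oplus>\<^bsub>R\<^esub>k\<in>supp x. ?f (h \<otimes> k))"
    using assms a supp_subset[of x]
    by (intro R.finsum_cong') (auto simp: inv subset_iff intro!: proj_in_carrier R.m_closed)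
  also have "\<dots> = (\<Oplus>\<^bsub>R\<^esub>k\<in>?F. ?f k)"
    using assms a supp_subset[of x]
    by (intro R.finsum_reindex[symmetric])
       (auto simp: inj_on_def subset_iff inv intro!: proj_in_carrier R.m_closed)
  finally have "proj (h \<otimes> g) (a \<otimes>\<^bsub>R\<^esub> x) =
      (if h \<otimes> g \<in> ?F then ?f (h \<otimes> g) else \<zero>\<^bsub>R\<^esub>)"
    using assms supp_subset[of x] finite_supp
    by (intro proj_eqI[of ?F]) (auto simp: subset_iff inv intro!: component_mult_closed proj_in)
  moreover have "h \<otimes> g \<in> ?F \<longleftrightarrow> g \<in> supp x"
    using assms supp_subset[of x] by (auto simp: subset_iff image_iff)
  ultimately show ?thesis
    using assms a by (auto simp: inv supp_def)
qed

text \<open>The component of degree \<open>\<one>\<close> of the unit is a right unit for homogeneous elements, hence for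
  all elements, hence equal to the unit.\<close>

lemma one_in_component: "\<one>\<^bsub>R\<^esub> \<in> A \<one>"
proof -
  let ?u = "proj \<one> \<one>\<^bsub>R\<^esub>"
  have u: "?u \<in> A \<one>" "?u \<in> carrier R"
    by (auto intro: proj_in proj_in_carrier)
  have hom: "x \<otimes>\<^bsub>R\<^esub> ?u = x" if "h \<in> carrier G" "x \<in> A h" for h x
    using proj_mult_left[of h \<one> x "\<one>\<^bsub>R\<^esub>"] that
    by (simp add: component_in_carrier proj_homogeneous)
  have "\<one>\<^bsub>R\<^esub> \<otimes>\<^bsub>R\<^esub> ?u = (\<Oplus>\<^bsub>R\<^esub>g\<in>supp \<one>\<^bsub>R\<^esub>. proj g \<one>\<^bsub>R\<^esub>) \<otimes>\<^bsub>R\<^esub> ?u"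
    using sum_proj[of "\<one>\<^bsub>R\<^esub>"] by simp
  also have "\<dots> = (\<Oplus>\<^bsub>R\<^esub>g\<in>supp \<one>\<^bsub>R\<^esub>. proj g \<one>\<^bsub>R\<^esub> \<otimes>\<^bsub>R\<^esub> ?u)"
    using u supp_subset finite_supp by (intro R.finsum_ldistr) (auto intro!: proj_in_carrier)
  also have "\<dots> = (\<Oplus>\<^bsub>R\<^esub>g\<in>supp \<one>\<^bsub>R\<^esub>. proj g \<one>\<^bsub>R\<^esub>)"
  proof (rule R.finsum_cong')
    show "proj g \<one>\<^bsub>R\<^esub> \<otimes>\<^bsub>R\<^esub> ?u = proj g \<one>\<^bsub>R\<^esub>" if "g \<in> supp \<one>\<^bsub>R\<^esub>" for g
      using that by (intro hom[of g] proj_in subsetD[OF supp_subset]) auto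
  qed (use supp_subset in \<open>auto intro!: proj_in_carrier\<close>)
  also have "\<dots> = \<one>\<^bsub>R\<^esub>"
    using sum_proj[of "\<one>\<^bsub>R\<^esub>"] by simp
  finally show ?thesis
    using u by simp
qed

lemma proj_mult_right:
  assumes "g \<in> carrier G" "a \<in> A \<one>" "x \<in> carrier R"
  shows "proj g (x \<otimes>\<^bsub>R\<^esub> a) = proj g x \<otimes>\<^bsub>R\<^esub> a"
proof -
  have a: "a \<in> carrier R"
    using assms component_in_carrier by blast
  have x: "proj k x \<otimes>\<^bsub>R\<^esub> a \<in> A k" if "k \<in> carrier G" for k
    using component_mult_closed[of k \<one>] proj_in that assms by auto
  have "x \<otimes>\<^bsub>R\<^esub> a = (\<Oplus>\<^bsub>R\<^esub>k\<in>supp x. proj k x) \<otimes>\<^bsub>R\<^esub> a"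
    using sum_proj assms by simp
  also have "\<dots> = (\<Oplus>\<^bsub>R\<^esub>k\<in>supp x. proj k x \<otimes>\<^bsub>R\<^esub> a)"
    using assms a supp_subset finite_supp by (intro R.finsum_ldistr) (auto intro!: proj_in_carrier)
  finally have "proj g (x \<otimes>\<^bsub>R\<^esub> a) = (if g \<in> supp x then proj g x \<otimes>\<^bsub>R\<^esub> a else \<zero>\<^bsub>R\<^esub>)"
    using assms supp_subset[of x] finite_supp x by (intro proj_eqI[of "supp x"]) auto
  then show ?thesis
    using assms a by (auto simp: supp_def)
qed

lemma graded_part_iff:
  assumes "H \<subseteq> carrier G"
  shows "x \<in> graded_part R A H \<longleftrightarrow> x \<in> carrier R \<and> supp x \<subseteq> H"
proof
  assume "x \<in> graded_part R A H"
  then obtain F f where F: "x = (\<Oplus>\<^bsub>R\<^esub>h\<in>F. f h)" "finite F" "F \<subseteq> H" "f \<in> (\<Pi> h\<in>F. A h)"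
    by (auto simp: graded_part_def)
  then have "f \<in> F \<rightarrow> carrier R"
    using assms component_in_carrier by blast
  then have "x \<in> carrier R"
    unfolding F(1) by (rule R.finsum_closed)
  moreover have "proj g x = (if g \<in> F then f g else \<zero>\<^bsub>R\<^esub>)" if "g \<in> carrier G" for g
    using F that assms by (intro proj_eqI) auto
  ultimately show "x \<in> carrier R \<and> supp x \<subseteq> H"
    using F by (auto simp: supp_def split: if_splits)
next
  assume "x \<in> carrier R \<and> supp x \<subseteq> H"
  then show "x \<in> graded_part R A H"
    unfolding graded_part_def using sum_proj[of x] finite_supp[of x] proj_in[of x] assms
    by (intro CollectI exI[of _ "supp x"] exI[of _ "\<lambda>h. proj h x"]) auto
qed

end


section \<open>Subbimodules of a graded ring\<close>

lemma bimodule_in_simps [simp]: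
  "carrier (ring_bimodule R) = carrier R" "carrier (bimodule_in R S) = S"
  "ring.zero (bimodule_in R S) = ring.zero R"
  "ring.add (bimodule_in R S) = ring.add R"
  "smult (bimodule_in R S) = monoid.mult R" "rsmult (bimodule_in R S) = monoid.mult R"
  "(bimodule_in R S)\<lparr>carrier := N\<rparr> = bimodule_in R N"
  "(ring_bimodule R)\<lparr>carrier := N\<rparr> = bimodule_in R N"
  by (simp_all add: bimodule_in_def ring_bimodule_def)

lemma identity_component_simps [simp]:
  "carrier (identity_component G R A) = A \<one>\<^bsub>G\<^esub>"
  "ring.zero (identity_component G R A) = ring.zero R"
  "ring.add (identity_component G R A) = ring.add R"
  "monoid.mult (identity_component G R A) = monoid.mult R"
  "monoid.one (identity_component G R A) = monoid.one R"
  by (simp_all add: identity_component_def)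

lemma ring_bimodule_identity_component:
  "ring_bimodule (identity_component G R A) = bimodule_in R (A \<one>\<^bsub>G\<^esub>)"
  by (simp add: ring_bimodule_def bimodule_in_def identity_component_def)

context graded_ring
begin

lemma ring_identity_component: "ring Re"
proof -
  have "subring (A \<one>) R"
    using component_mult_closed[of \<one> \<one>]
    by (intro R.subringI) (auto simp: one_in_component component_closed component_in_carrier)
  then show ?thesis
    unfolding identity_component_def by (rule R.subring_is_ring)
qed

text \<open>Subbimodules of \<open>R\<close> over \<open>Re\<close>, described by closure conditions inside \<open>R\<close> instead of the
  axioms of a bimodule record.\<close>

definition stable :: "'c set \<Rightarrow> bool"
  where "stable N \<longleftrightarrow> additive_subgroup N R \<and>
    (\<forall>a \<in> A \<one>. \<forall>x \<in> N. a \<otimes>\<^bsub>R\<^esub> x \<in> N \<and> x \<otimes>\<^bsub>R\<^esub> a \<in> N)"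

lemma stableI:
  assumes "N \<subseteq> carrier R" "\<zero>\<^bsub>R\<^esub> \<in> N" "\<And>x y. \<lbrakk>x \<in> N; y \<in> N\<rbrakk> \<Longrightarrow> x \<oplus>\<^bsub>R\<^esub> y \<in> N"
    and "\<And>x. x \<in> N \<Longrightarrow> \<ominus>\<^bsub>R\<^esub> x \<in> N"
    and "\<And>a x. \<lbrakk>a \<in> A \<one>; x \<in> N\<rbrakk> \<Longrightarrow> a \<otimes>\<^bsub>R\<^esub> x \<in> N"
    and "\<And>a x. \<lbrakk>a \<in> A \<one>; x \<in> N\<rbrakk> \<Longrightarrow> x \<otimes>\<^bsub>R\<^esub> a \<in> N"
  shows "stable N"
proof -
  have "subgroup N (add_monoid R)"
    using assms by (intro subgroup.intro) (auto simp flip: a_inv_def)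
  with assms(5,6) show ?thesis
    by (simp add: stable_def additive_subgroup.intro)
qed

lemma stableD:
  assumes "stable N"
  shows "N \<subseteq> carrier R" "\<zero>\<^bsub>R\<^esub> \<in> N" "\<lbrakk>x \<in> N; y \<in> N\<rbrakk> \<Longrightarrow> x \<oplus>\<^bsub>R\<^esub> y \<in> N"
    and "x \<in> N \<Longrightarrow> \<ominus>\<^bsub>R\<^esub> x \<in> N"
    and "\<lbrakk>a \<in> A \<one>; x \<in> N\<rbrakk> \<Longrightarrow> a \<otimes>\<^bsub>R\<^esub> x \<in> N"
    and "\<lbrakk>a \<in> A \<one>; x \<in> N\<rbrakk> \<Longrightarrow> x \<otimes>\<^bsub>R\<^esub> a \<in> N"
proof -
  interpret additive_subgroup N R
    using assms by (simp add: stable_def)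
  show "N \<subseteq> carrier R" "\<zero>\<^bsub>R\<^esub> \<in> N" "\<lbrakk>x \<in> N; y \<in> N\<rbrakk> \<Longrightarrow> x \<oplus>\<^bsub>R\<^esub> y \<in> N"
    by (auto simp: a_subset)
  show "\<ominus>\<^bsub>R\<^esub> x \<in> N" if "x \<in> N"
    using that by (rule a_inv_closed)
qed (use assms in \<open>auto simp: stable_def\<close>)

lemma stable_in_carrier: "\<lbrakk>stable N; x \<in> N\<rbrakk> \<Longrightarrow> x \<in> carrier R"
  using stableD(1) by blast

lemma component_stable: "g \<in> carrier G \<Longrightarrow> stable (A g)"
  using component_mult_closed[of \<one> g] component_mult_closed[of g \<one>]
  by (intro stableI) (auto simp: component_closed component_in_carrier)

lemma bimodule_in_iff:
  assumes "N \<subseteq> carrier R"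
  shows "bimodule Re (bimodule_in R N) \<longleftrightarrow> stable N"
proof
  assume "bimodule Re (bimodule_in R N)"
  then interpret bimodule Re "bimodule_in R N" .
  show "stable N"
  proof (rule stableI)
    fix x assume x: "x \<in> N"
    let ?y = "\<ominus>\<^bsub>bimodule_in R N\<^esub> x"
    have "?y \<in> N" "?y \<oplus>\<^bsub>R\<^esub> x = \<zero>\<^bsub>R\<^esub>"
      using M.a_inv_closed[of x] M.l_neg[of x] x by auto
    then have "\<ominus>\<^bsub>R\<^esub> x = ?y"
      using assms x by (intro R.minus_equality) auto
    with \<open>?y \<in> N\<close> show "\<ominus>\<^bsub>R\<^esub> x \<in> N"
      by simp
  qed (use assms M.zero_closed M.a_closed smult_closed rsmult_closed in auto)
next
  assume "stable N"
  note N = stableD[OF this] and c = stable_in_carrier[OF this]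
  have "abelian_group (bimodule_in R N)"
  proof (rule abelian_groupI)
    show "\<exists>y \<in> carrier (bimodule_in R N). y \<oplus>\<^bsub>bimodule_in R N\<^esub> x = \<zero>\<^bsub>bimodule_in R N\<^esub>"
      if "x \<in> carrier (bimodule_in R N)" for x
      using that N(4) c R.l_neg by (intro bexI[of _ "\<ominus>\<^bsub>R\<^esub> x"]) auto
  qed (use N c in \<open>auto simp: R.a_ac\<close>)
  then show "bimodule Re (bimodule_in R N)"
    using N c component_in_carrier[OF G.one_closed]
    by (intro bimodule.intro bimodule_axioms.intro ring_identity_component)
       (auto simp: R.m_assoc R.l_distr R.r_distr)
qed

lemma subbimodule_in_iff:
  "S \<subseteq> carrier R \<Longrightarrow> subbimodule Re N (bimodule_in R S) \<longleftrightarrow> N \<subseteq> S \<and> stable N"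
  using bimodule_in_iff[of N] by (auto simp: subbimodule_def)

lemma subbimodule_ring_iff: "subbimodule Re N (ring_bimodule R) \<longleftrightarrow> stable N"
  using bimodule_in_iff[of N] stableD(1)[of N] by (auto simp: subbimodule_def)

lemma simple_bimodule_in_iff:
  "stable S \<Longrightarrow> simple_bimodule Re (bimodule_in R S) \<longleftrightarrow>
    S \<noteq> {\<zero>\<^bsub>R\<^esub>} \<and> (\<forall>N. stable N \<and> N \<subseteq> S \<longrightarrow> N = {\<zero>\<^bsub>R\<^esub>} \<or> N = S)"
  using bimodule_in_iff[of S] subbimodule_in_iff[of S] stableD(1)[of S]
  by (auto simp: simple_bimodule_def)

abbreviation isomorphic_parts :: "'c set \<Rightarrow> 'c set \<Rightarrow> bool"
  where "isomorphic_parts S T \<equiv> bimodule_isomorphic Re (bimodule_in R S) (bimodule_in R T)"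

abbreviation hom_parts :: "'c set \<Rightarrow> 'c set \<Rightarrow> ('c \<Rightarrow> 'c) set"
  where "hom_parts S T \<equiv> bimodule_hom Re (bimodule_in R S) (bimodule_in R T)"

lemma isomorphic_parts_iff: "isomorphic_parts S T \<longleftrightarrow> (\<exists>f \<in> hom_parts S T. bij_betw f S T)"
  by (simp add: bimodule_isomorphic_iff)

lemmas hom_partsD = bimodule_homD[where M = "bimodule_in R S" and N = "bimodule_in R T" and T = Re
    for S T, simplified]

lemma hom_parts_zero:
  assumes "stable S" "stable T" "f \<in> hom_parts S T"
  shows "f \<zero>\<^bsub>R\<^esub> = \<zero>\<^bsub>R\<^esub>"
proof -
  have "f \<zero>\<^bsub>R\<^esub> \<in> carrier R"
    using hom_partsD(1)[OF assms(3)] assms stableD(2) stable_in_carrier by blast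
  then show ?thesis
    using hom_partsD(2)[OF assms(3), of "\<zero>\<^bsub>R\<^esub>" "\<zero>\<^bsub>R\<^esub>"] assms stableD(2)
    by (simp add: R.add.l_cancel_one)
qed

lemma hom_parts_minus:
  assumes "stable S" "stable T" "f \<in> hom_parts S T" "x \<in> S"
  shows "f (\<ominus>\<^bsub>R\<^esub> x) = \<ominus>\<^bsub>R\<^esub> f x"
proof -
  have "f x \<in> carrier R" "f (\<ominus>\<^bsub>R\<^esub> x) \<in> carrier R" "\<ominus>\<^bsub>R\<^esub> x \<in> S"
    using hom_partsD(1)[OF assms(3)] assms stableD(4) stable_in_carrier by blast+
  then show ?thesis
    using hom_partsD(2)[OF assms(3), of "\<ominus>\<^bsub>R\<^esub> x" x] hom_parts_zero[OF assms(1-3)] assms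
    by (simp add: R.l_neg stable_in_carrier R.minus_equality)
qed

lemma stable_inter: "\<lbrakk>stable M; stable N\<rbrakk> \<Longrightarrow> stable (M \<inter> N)"
  by (rule stableI) (auto simp: stableD stable_in_carrier)

lemma stable_image:
  assumes "stable S" "stable T" "f \<in> hom_parts S T" "stable N" "N \<subseteq> S"
  shows "stable (f ` N)"
proof (rule stableI)
  note f = hom_partsD[OF assms(3)] and N = stableD[OF assms(4)]
  have S: "x \<in> S" if "x \<in> N" for x
    using that assms(5) by blast
  show "f ` N \<subseteq> carrier R"
    using f(1) S stableD(1)[OF assms(2)] by blast
  show "\<zero>\<^bsub>R\<^esub> \<in> f ` N"
    using hom_parts_zero[OF assms(1-3)] N(2) by force
  show "x \<oplus>\<^bsub>R\<^esub> y \<in> f ` N" if "x \<in> f ` N" "y \<in> f ` N" for x y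
    using that N(3) S by (auto simp flip: f(2))
  show "\<ominus>\<^bsub>R\<^esub> x \<in> f ` N" if "x \<in> f ` N" for x
    using that N(4) S by (auto simp flip: hom_parts_minus[OF assms(1-3)])
  show "a \<otimes>\<^bsub>R\<^esub> x \<in> f ` N" if "a \<in> A \<one>" "x \<in> f ` N" for a x
    using that N(5) S by (auto simp flip: f(3))
  show "x \<otimes>\<^bsub>R\<^esub> a \<in> f ` N" if "a \<in> A \<one>" "x \<in> f ` N" for a x
    using that N(6) S by (auto simp flip: f(4))
qed

lemma stable_kernel:
  assumes "stable S" "stable T" "f \<in> hom_parts S T"
  shows "stable {x \<in> S. f x = \<zero>\<^bsub>R\<^esub>}"
proof (rule stableI)
  note f = hom_partsD[OF assms(3)] and S = stableD[OF assms(1)]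
  show "{x \<in> S. f x = \<zero>\<^bsub>R\<^esub>} \<subseteq> carrier R"
    using S(1) by blast
qed (use hom_parts_minus[OF assms] hom_parts_zero[OF assms] hom_partsD[OF assms(3)]
      stableD[OF assms(1)] component_in_carrier[OF G.one_closed] in auto)

lemma hom_parts_inj_onI:
  assumes "stable S" "stable T" "f \<in> hom_parts S T" "\<And>x. \<lbrakk>x \<in> S; f x = \<zero>\<^bsub>R\<^esub>\<rbrakk> \<Longrightarrow> x = \<zero>\<^bsub>R\<^esub>"
  shows "inj_on f S"
proof (rule inj_onI)
  fix x y assume xy: "x \<in> S" "y \<in> S" "f x = f y"
  note f = hom_partsD[OF assms(3)] and c = stable_in_carrier[OF assms(1)] stable_in_carrier[OF assms(2)]
  have "f (x \<oplus>\<^bsub>R\<^esub> \<ominus>\<^bsub>R\<^esub> y) = \<zero>\<^bsub>R\<^esub>"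
    using xy stableD(4)[OF assms(1)] f(1)[of y] c
    by (simp add: f(2) hom_parts_minus[OF assms(1-3)] R.r_neg)
  then have "x \<oplus>\<^bsub>R\<^esub> \<ominus>\<^bsub>R\<^esub> y = \<zero>\<^bsub>R\<^esub>"
    using xy stableD(3,4)[OF assms(1)] assms(4)[of "x \<oplus>\<^bsub>R\<^esub> \<ominus>\<^bsub>R\<^esub> y"] by simp
  then have "x \<ominus>\<^bsub>R\<^esub> y = \<zero>\<^bsub>R\<^esub>"
    unfolding a_minus_def .
  then show "x = y"
    by (rule iffD1[OF R.r_right_minus_eq[OF c(1)[OF xy(1)] c(1)[OF xy(2)]]])
qed

text \<open>Schur's lemma: the image and the kernel of a homomorphism are subbimodules, so a nonzero
  homomorphism is surjective if its target is simple and injective if its source is simple.\<close>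

lemma hom_parts_onto_simple:
  assumes "stable S" "stable T" "simple_bimodule Re (bimodule_in R T)" "f \<in> hom_parts S T"
    and "x \<in> S" "f x \<noteq> \<zero>\<^bsub>R\<^esub>"
  shows "f ` S = T"
proof -
  have "f ` S \<subseteq> T"
    using hom_partsD(1)[OF assms(4)] by blast
  moreover have "stable (f ` S)"
    using assms by (intro stable_image[of S T]) auto
  moreover have "f ` S \<noteq> {\<zero>\<^bsub>R\<^esub>}"
    using assms(5,6) by blast
  ultimately show ?thesis
    using assms(3) unfolding simple_bimodule_in_iff[OF assms(2)] by blast
qed

lemma schur:
  assumes "stable S" "simple_bimodule Re (bimodule_in R S)"
    and "stable T" "simple_bimodule Re (bimodule_in R T)"
    and f: "f \<in> hom_parts S T" and x: "x \<in> S" "f x \<noteq> \<zero>\<^bsub>R\<^esub>"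
  shows "bij_betw f S T"
proof -
  let ?K = "{x \<in> S. f x = \<zero>\<^bsub>R\<^esub>}"
  have "stable ?K" "?K \<subseteq> S" "?K \<noteq> S"
    using assms stable_kernel by auto
  then have "?K = {\<zero>\<^bsub>R\<^esub>}"
    using assms by (auto simp: simple_bimodule_in_iff)
  then have "inj_on f S"
    using assms by (intro hom_parts_inj_onI) auto
  with hom_parts_onto_simple[OF assms(1,3,4) f x] show ?thesis
    by (simp add: bij_betw_def)
qed

lemma graded_part_stable:
  assumes "H \<subseteq> carrier G"
  shows "stable (graded_part R A H)"
proof (rule stableI)
  have zero: "proj g x = \<zero>\<^bsub>R\<^esub>" if "supp x \<subseteq> H" "g \<in> carrier G" "g \<notin> H" for g x
    using that by (auto simp: supp_def)
  have supp: "supp x \<subseteq> H" if "\<And>g. \<lbrakk>g \<in> carrier G; g \<notin> H\<rbrakk> \<Longrightarrow> proj g x = \<zero>\<^bsub>R\<^esub>" for x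
    using that by (auto simp: supp_def)
  show "x \<oplus>\<^bsub>R\<^esub> y \<in> graded_part R A H"
    if "x \<in> graded_part R A H" "y \<in> graded_part R A H" for x y
    using that assms by (auto simp: graded_part_iff proj_add zero intro!: supp)
  fix a x assume a: "a \<in> A \<one>" and x: "x \<in> graded_part R A H"
  then have "a \<in> carrier R" "x \<in> carrier R" "supp x \<subseteq> H"
    using component_in_carrier assms by (auto simp: graded_part_iff)
  then show "a \<otimes>\<^bsub>R\<^esub> x \<in> graded_part R A H" "x \<otimes>\<^bsub>R\<^esub> a \<in> graded_part R A H"
    using a assms proj_mult_left[of \<one> _ a x] proj_mult_right[of _ a x]
    by (auto simp: graded_part_iff zero intro!: supp)
qed (use assms in \<open>auto simp: graded_part_iff supp_def proj_zero proj_minus\<close>)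

lemma component_subset_graded_part:
  "\<lbrakk>H \<subseteq> carrier G; g \<in> H\<rbrakk> \<Longrightarrow> A g \<subseteq> graded_part R A H"
  using proj_homogeneous component_in_carrier
  by (auto simp: graded_part_iff supp_def subset_iff split: if_splits)

lemma graded_part_singleton:
  assumes "g \<in> carrier G"
  shows "graded_part R A {g} = A g"
proof
  show "graded_part R A {g} \<subseteq> A g"
  proof
    fix x assume "x \<in> graded_part R A {g}"
    then have x: "x \<in> carrier R" "supp x \<subseteq> {g}"
      using assms by (auto simp: graded_part_iff)
    have "x = proj g x"
      using sum_proj_superset[OF x(1) _ x(2)] assms x(1) by (simp add: proj_in_carrier R.finsum_insert)
    then show "x \<in> A g"
      using proj_in[OF x(1) assms] by simp
  qed
  show "A g \<subseteq> graded_part R A {g}"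
    using component_subset_graded_part[of "{g}"] assms by simp
qed

lemma graded_part_empty: "graded_part R A {} = {\<zero>\<^bsub>R\<^esub>}"
  using supp_eq_empty by (auto simp: graded_part_iff)

lemma proj_hom_parts:
  assumes "stable S" "g \<in> carrier G"
  shows "proj g \<in> hom_parts S (A g)"
  using assms proj_mult_left[of \<one> g] proj_mult_right[of g] stable_in_carrier[OF assms(1)]
  by (intro bimodule_homI) (auto simp: proj_in proj_add)

end


section \<open>Control by the grading group\<close>

context graded_ring
begin

lemma stable_finsum:
  assumes N: "stable N" and "finite F" "\<And>i. i \<in> F \<Longrightarrow> f i \<in> N"
  shows "(\<Oplus>\<^bsub>R\<^esub>i\<in>F. f i) \<in> N"
  using assms(2,3)
proof (induction F rule: finite_induct)
  case (insert i F)
  then have "(\<Oplus>\<^bsub>R\<^esub>i\<in>insert i F. f i) = f i \<oplus>\<^bsub>R\<^esub> (\<Oplus>\<^bsub>R\<^esub>i\<in>F. f i)"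
    by (intro R.finsum_insert) (auto intro: stable_in_carrier[OF N])
  with insert show ?case
    by (auto intro: stableD[OF N])
qed (simp add: stableD[OF N])

lemma finsum_bimodule_in:
  assumes N: "stable N" and "finite F" "\<And>i. i \<in> F \<Longrightarrow> f i \<in> N"
  shows "(\<Oplus>\<^bsub>bimodule_in R N\<^esub>i\<in>F. f i) = (\<Oplus>\<^bsub>R\<^esub>i\<in>F. f i)"
proof -
  have "bimodule Re (bimodule_in R N)"
    using N bimodule_in_iff stableD(1) by blast
  then interpret N: bimodule Re "bimodule_in R N" .
  show ?thesis
    using assms(2,3)
  proof (induction F rule: finite_induct)
    case empty
    show ?case
      using N.M.finsum_empty by simp
  next
    case (insert i F)
    then have "(\<Oplus>\<^bsub>bimodule_in R N\<^esub>i\<in>insert i F. f i) = f i \<oplus>\<^bsub>R\<^esub> (\<Oplus>\<^bsub>bimodule_in R N\<^esub>i\<in>F. f i)"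
      using N.M.finsum_insert[of F i f] by auto
    moreover have "(\<Oplus>\<^bsub>R\<^esub>i\<in>insert i F. f i) = f i \<oplus>\<^bsub>R\<^esub> (\<Oplus>\<^bsub>R\<^esub>i\<in>F. f i)"
      using insert by (intro R.finsum_insert) (auto intro: stable_in_carrier[OF N])
    ultimately show ?case
      using insert by simp
  qed
qed

lemma hom_parts_finsum:
  assumes S: "stable S" and T: "stable T" and f: "f \<in> hom_parts S T"
    and "finite F" "\<And>i. i \<in> F \<Longrightarrow> x i \<in> S"
  shows "f (\<Oplus>\<^bsub>R\<^esub>i\<in>F. x i) = (\<Oplus>\<^bsub>R\<^esub>i\<in>F. f (x i))"
  using assms(4,5)
proof (induction F rule: finite_induct)
  case empty
  then show ?case
    using hom_parts_zero[OF S T f] by simp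
next
  case (insert i F)
  have "(\<Oplus>\<^bsub>R\<^esub>j\<in>insert i F. x j) = x i \<oplus>\<^bsub>R\<^esub> (\<Oplus>\<^bsub>R\<^esub>j\<in>F. x j)"
    using insert by (intro R.finsum_insert) (auto intro: stable_in_carrier[OF S])
  moreover have "(\<Oplus>\<^bsub>R\<^esub>j\<in>insert i F. f (x j)) = f (x i) \<oplus>\<^bsub>R\<^esub> (\<Oplus>\<^bsub>R\<^esub>j\<in>F. f (x j))"
    using insert by (intro R.finsum_insert) (auto intro!: stable_in_carrier[OF T] hom_partsD(1)[OF f])
  ultimately show ?case
    using insert by (simp add: hom_partsD(2)[OF f] stable_finsum[OF S])
qed

definition simple_components :: bool
  where "simple_components \<longleftrightarrow> (\<forall>g \<in> carrier G. simple_bimodule Re (bimodule_in R (A g)))"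

definition nonisomorphic_components :: bool
  where "nonisomorphic_components \<longleftrightarrow>
    (\<forall>g \<in> carrier G. \<forall>h \<in> carrier G. isomorphic_parts (A g) (A h) \<longrightarrow> g = h)"

lemma simple_componentsD:
  assumes "simple_components" "g \<in> carrier G"
  shows "simple_bimodule Re (bimodule_in R (A g))"
    and "A g \<noteq> {\<zero>\<^bsub>R\<^esub>}"
    and "\<lbrakk>stable N; N \<subseteq> A g\<rbrakk> \<Longrightarrow> N = {\<zero>\<^bsub>R\<^esub>} \<or> N = A g"
proof -
  show simple: "simple_bimodule Re (bimodule_in R (A g))"
    using assms by (simp add: simple_components_def)
  then show "A g \<noteq> {\<zero>\<^bsub>R\<^esub>}" "\<lbrakk>stable N; N \<subseteq> A g\<rbrakk> \<Longrightarrow> N = {\<zero>\<^bsub>R\<^esub>} \<or> N = A g"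
    using simple_bimodule_in_iff[OF component_stable[OF assms(2)]] by auto
qed

lemma simple_components_nonzero:
  assumes "simple_components" "g \<in> carrier G"
  obtains x where "x \<in> A g" "x \<noteq> \<zero>\<^bsub>R\<^esub>"
  using simple_componentsD(2)[OF assms] component_closed(2)[OF assms(2)] by blast

text \<open>By Schur's lemma, pairwise non-isomorphic simple components admit only zero maps between
  different degrees.\<close>

lemma nonisomorphic_componentsD:
  assumes "simple_components" "nonisomorphic_components" "g \<in> carrier G" "h \<in> carrier G"
    and "f \<in> hom_parts (A g) (A h)" "x \<in> A g" "f x \<noteq> \<zero>\<^bsub>R\<^esub>"
  shows "g = h"
proof -
  have "bij_betw f (A g) (A h)"
    using assms by (intro schur simple_componentsD component_stable)
  with assms show ?thesis
    unfolding nonisomorphic_components_def isomorphic_parts_iff by blast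
qed

text \<open>The heart of the matter: \<open>R\<close> is a direct sum of pairwise non-isomorphic simple bimodules, so
  a subbimodule contains every component onto which it has a nonzero projection. The proof is by
  induction on the size of the support of \<open>x\<close>. If \<open>M\<close> has a nonzero element \<open>y\<close> with smaller support
  inside that of \<open>x\<close>, then \<open>M\<close> contains a whole component of degree in the support of \<open>x\<close>, which can
  be subtracted from \<open>x\<close>. Otherwise the elements of \<open>M\<close> supported where \<open>x\<close> is are isomorphic,
  by projection, to every component that occurs in \<open>x\<close>; so only one component occurs.\<close>

lemma components_subset_of_stable:
  assumes sim: "simple_components" and noniso: "nonisomorphic_components" and M: "stable M"
    and "x \<in> M" "g \<in> supp x"
  shows "A g \<subseteq> M"
  using assms(4,5)
proof (induction "card (supp x)" arbitrary: x g rule: less_induct)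
  case less
  have x: "x \<in> carrier R"
    using less.prems M stable_in_carrier by blast
  have fin: "finite (supp x)"
    using x by (rule finite_supp)
  have g: "g \<in> carrier G"
    using less.prems supp_subset by blast
  show ?case
  proof (cases "\<exists>y \<in> M. y \<noteq> \<zero>\<^bsub>R\<^esub> \<and> supp y \<subset> supp x")
    case True
    then obtain y where y: "y \<in> M" "y \<noteq> \<zero>\<^bsub>R\<^esub>" "supp y \<subset> supp x"
      by blast
    then obtain k where k: "k \<in> supp y"
      using supp_eq_empty stable_in_carrier[OF M] by blast
    have kG: "k \<in> carrier G" "k \<in> supp x"
      using k y supp_subset by auto
    have Ak: "A k \<subseteq> M"
      using less.hyps[of y k] y k fin by (simp add: psubset_card_mono)
    \<comment> \<open>Removing the component of degree \<open>k\<close> from \<open>x\<close> stays in \<open>M\<close> and shortens the support.\<close>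
    let ?x = "x \<oplus>\<^bsub>R\<^esub> \<ominus>\<^bsub>R\<^esub> proj k x"
    have "proj h ?x = (if h = k then \<zero>\<^bsub>R\<^esub> else proj h x)" if "h \<in> carrier G" for h
      using that x kG proj_homogeneous[of h k "proj k x"] proj_in[OF x kG(1)]
      by (auto simp: proj_add proj_minus proj_in_carrier R.r_neg)
    then have "supp ?x = supp x - {k}"
      by (auto simp: supp_def split: if_splits)
    moreover from this have "card (supp ?x) < card (supp x)"
      using card_Diff1_less[OF fin kG(2)] by simp
    moreover have "?x \<in> M"
      using stableD(3,4)[OF M] less.prems(1) Ak proj_in[OF x kG(1)] by auto
    ultimately show ?thesis
      using less.hyps[of ?x g] less.prems(2) Ak by (cases "g = k") auto
  next
    case False
    let ?M = "M \<inter> graded_part R A (supp x)"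
    have stable: "stable ?M"
      by (intro stable_inter M graded_part_stable supp_subset)
    have xM: "x \<in> ?M"
      using less.prems x supp_subset by (simp add: graded_part_iff)
    \<comment> \<open>By minimality of the support, each projection is injective on this subbimodule.\<close>
    have iso: "bimodule_isomorphic Re (bimodule_in R ?M) (bimodule_in R (A h))"
      if h: "h \<in> supp x" for h
    proof -
      have hG: "h \<in> carrier G"
        using h supp_subset by blast
      have hom: "proj h \<in> hom_parts ?M (A h)"
        using stable hG by (rule proj_hom_parts)
      have "y = \<zero>\<^bsub>R\<^esub>" if "y \<in> ?M" "proj h y = \<zero>\<^bsub>R\<^esub>" for y
      proof -
        have "supp y \<subset> supp x"
          using that h supp_subset[of x] by (auto simp: graded_part_iff supp_def)
        with False that show ?thesis
          by blast
      qed
      then have "inj_on (proj h) ?M"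
        by (rule hom_parts_inj_onI[OF stable component_stable[OF hG] hom])
      moreover have "proj h ` ?M = A h"
        using h by (intro hom_parts_onto_simple[OF stable component_stable[OF hG] _ hom xM]
            simple_componentsD(1)[OF sim hG]) (simp add: supp_def)
      ultimately show ?thesis
        using hom unfolding isomorphic_parts_iff bij_betw_def by blast
    qed
    have "h = g" if h: "h \<in> supp x" for h
    proof -
      have "bimodule Re (bimodule_in R ?M)"
        using stable bimodule_in_iff stableD(1) by blast
      then have "isomorphic_parts (A h) (A g)"
        using iso[OF h] iso[OF less.prems(2)] bimodule_isomorphic_sym bimodule_isomorphic_trans
        by blast
      then show ?thesis
        using noniso g h supp_subset[of x] by (auto simp: nonisomorphic_components_def)
    qed
    then have "supp x = {g}"
      using less.prems(2) by blast
    then have "?M \<subseteq> A g" "x \<noteq> \<zero>\<^bsub>R\<^esub>"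
      using graded_part_singleton[OF g] supp_eq_empty[OF x] by auto
    then have "?M = A g"
      using simple_componentsD(3)[OF sim g stable] xM by blast
    then show ?thesis
      by blast
  qed
qed

text \<open>An isomorphism embeds \<open>A g\<close>, for \<open>g \<in> S\<close>, into the sum of the \<open>A h\<close> with \<open>h \<in> T\<close>. Some
  projection of the image is nonzero, which forces \<open>g = h\<close>.\<close>

lemma isomorphic_graded_parts_subset:
  assumes sim: "simple_components" and noniso: "nonisomorphic_components"
    and S: "S \<subseteq> carrier G" and T: "T \<subseteq> carrier G"
    and iso: "isomorphic_parts (graded_part R A S) (graded_part R A T)"
  shows "S \<subseteq> T"
proof
  fix g assume g: "g \<in> S"
  then have gG: "g \<in> carrier G"
    using S by blast
  note sS = graded_part_stable[OF S] and sT = graded_part_stable[OF T]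
  obtain f where f: "f \<in> hom_parts (graded_part R A S) (graded_part R A T)"
    and bij: "bij_betw f (graded_part R A S) (graded_part R A T)"
    using iso by (auto simp: isomorphic_parts_iff)
  note sub = component_subset_graded_part[OF S g]
  obtain x where x: "x \<in> A g" "x \<noteq> \<zero>\<^bsub>R\<^esub>"
    using simple_components_nonzero[OF sim gG] .
  have fx: "f x \<in> graded_part R A T"
    using hom_partsD(1)[OF f] sub x by blast
  have "f x \<noteq> \<zero>\<^bsub>R\<^esub>"
    using bij x sub hom_parts_zero[OF sS sT f] stableD(2)[OF sS]
    unfolding bij_betw_def inj_on_def by (metis subsetD)
  then obtain h where h: "h \<in> supp (f x)"
    using supp_eq_empty[of "f x"] fx T by (auto simp: graded_part_iff)
  then have hT: "h \<in> T" "h \<in> carrier G"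
    using fx T by (auto simp: graded_part_iff)
  have "f \<in> hom_parts (A g) (graded_part R A T)"
    using f sub by (auto simp: bimodule_hom_def subset_iff)
  then have "proj h \<circ> f \<in> hom_parts (A g) (A h)"
    by (rule bimodule_hom_compose[OF _ proj_hom_parts[OF sT hT(2)]])
  then have "g = h"
    using nonisomorphic_componentsD[OF sim noniso gG hT(2) _ x(1)] h by (simp add: supp_def)
  with hT show "g \<in> T"
    by simp
qed

lemma controlledI:
  assumes sim: "simple_components" and noniso: "nonisomorphic_components"
  shows "controlled G R A"
proof -
  have "inj_on (graded_part R A) (Pow (carrier G))"
  proof (rule inj_onI)
    fix H K assume HK: "H \<in> Pow (carrier G)" "K \<in> Pow (carrier G)"
      and eq: "graded_part R A H = graded_part R A K"
    have "H' \<subseteq> K'" if "H' \<subseteq> carrier G" "K' \<subseteq> carrier G" "graded_part R A H' = graded_part R A K'"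
      for H' K'
      using isomorphic_graded_parts_subset[OF sim noniso that(1,2)] that(3)
      by (simp add: bimodule_isomorphic_refl)
    with HK eq show "H = K"
      by (metis Pow_iff subset_antisym)
  qed
  moreover have "graded_part R A ` Pow (carrier G) = {M. subbimodule Re M (ring_bimodule R)}"
  proof
    show "graded_part R A ` Pow (carrier G) \<subseteq> {M. subbimodule Re M (ring_bimodule R)}"
      using graded_part_stable by (auto simp: subbimodule_ring_iff)
    show "{M. subbimodule Re M (ring_bimodule R)} \<subseteq> graded_part R A ` Pow (carrier G)"
    proof
      fix M assume "M \<in> {M. subbimodule Re M (ring_bimodule R)}"
      then have M: "stable M"
        by (simp add: subbimodule_ring_iff)
      let ?H = "{g \<in> carrier G. A g \<subseteq> M}"
      have "M = graded_part R A ?H"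
      proof (intro subset_antisym subsetI)
        fix x assume x: "x \<in> M"
        then have "supp x \<subseteq> ?H"
          using components_subset_of_stable[OF sim noniso M x] supp_subset by blast
        with x show "x \<in> graded_part R A ?H"
          using stable_in_carrier[OF M] by (simp add: graded_part_iff)
      next
        fix x assume "x \<in> graded_part R A ?H"
        then have x: "x \<in> carrier R" "supp x \<subseteq> ?H"
          by (auto simp: graded_part_iff)
        have "(\<Oplus>\<^bsub>R\<^esub>g\<in>supp x. proj g x) \<in> M"
          using x proj_in[OF x(1)] by (intro stable_finsum[OF M] finite_supp) auto
        then show "x \<in> M"
          using sum_proj[OF x(1)] by simp
      qed
      then show "M \<in> graded_part R A ` Pow (carrier G)"
        by blast
    qed
  qed
  moreover have "isomorphic_parts (graded_part R A S) (graded_part R A T) \<longleftrightarrow> S = T"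
    if S: "S \<subseteq> carrier G" and T: "T \<subseteq> carrier G" for S T
  proof
    assume iso: "isomorphic_parts (graded_part R A S) (graded_part R A T)"
    have "bimodule Re (bimodule_in R (graded_part R A S))"
      using graded_part_stable[OF S] bimodule_in_iff stableD(1) by blast
    then show "S = T"
      using isomorphic_graded_parts_subset[OF sim noniso S T iso]
        isomorphic_graded_parts_subset[OF sim noniso T S bimodule_isomorphic_sym[OF _ iso]]
      by blast
  qed (simp add: bimodule_isomorphic_refl)
  ultimately show ?thesis
    unfolding controlled_def bij_betw_def by blast
qed

lemma controlled_simple_components:
  assumes "controlled G R A"
  shows "simple_components"
  unfolding simple_components_def
proof
  fix g assume g: "g \<in> carrier G"
  have inj: "H = K" if "H \<subseteq> carrier G" "K \<subseteq> carrier G" "graded_part R A H = graded_part R A K" for H K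
    using assms that unfolding controlled_def bij_betw_def inj_on_def by blast
  have nonzero: "A h \<noteq> {\<zero>\<^bsub>R\<^esub>}" if "h \<in> carrier G" for h
    using inj[of "{h}" "{}"] that graded_part_singleton graded_part_empty by auto
  have "N = {\<zero>\<^bsub>R\<^esub>} \<or> N = A g" if N: "stable N" "N \<subseteq> A g" for N
  proof -
    have "N \<in> graded_part R A ` Pow (carrier G)"
      using assms N unfolding controlled_def bij_betw_def by (simp add: subbimodule_ring_iff)
    then obtain H where H: "H \<subseteq> carrier G" "N = graded_part R A H"
      by blast
    have "h = g" if "h \<in> H" for h
    proof (rule ccontr)
      assume "h \<noteq> g"
      moreover have "A h \<subseteq> A g" "h \<in> carrier G"
        using component_subset_graded_part[OF H(1) that] H N that by auto
      ultimately have "A h \<subseteq> {\<zero>\<^bsub>R\<^esub>}"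
        using component_inter g by blast
      then show False
        using nonzero component_closed(2) \<open>h \<in> carrier G\<close> by blast
    qed
    then have "H = {} \<or> H = {g}"
      by blast
    then show ?thesis
      using H graded_part_empty graded_part_singleton[OF g] by blast
  qed
  then show "simple_bimodule Re (bimodule_in R (A g))"
    using nonzero[OF g] by (simp add: simple_bimodule_in_iff component_stable g)
qed

lemma controlled_nonisomorphic_components:
  assumes "controlled G R A"
  shows "nonisomorphic_components"
  unfolding nonisomorphic_components_def
proof (intro ballI impI)
  fix g h assume gh: "g \<in> carrier G" "h \<in> carrier G" "isomorphic_parts (A g) (A h)"
  then have "isomorphic_parts (graded_part R A {g}) (graded_part R A {h})"
    by (simp add: graded_part_singleton)
  moreover have "{g} \<subseteq> carrier G" "{h} \<subseteq> carrier G"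
    using gh by auto
  ultimately have "{g} = {h}"
    using assms unfolding controlled_def by blast
  then show "g = h"
    by simp
qed

text \<open>If \<open>x\<close> centralizes the identity component then so does each of its components \<open>c\<close>, and then
  \<open>a \<mapsto> a c\<close> is a bimodule homomorphism out of \<open>A \<one>\<close>. It is nonzero at the unit, so the degree of \<open>c\<close>
  must be \<open>\<one>\<close>.\<close>

lemma centralizer_eq_center:
  assumes sim: "simple_components" and noniso: "nonisomorphic_components"
  shows "centralizer R (A \<one>) = center Re"
proof
  show "center Re \<subseteq> centralizer R (A \<one>)"
    using component_in_carrier by (auto simp: center_def centralizer_def)
  show "centralizer R (A \<one>) \<subseteq> center Re"
  proof
    fix x assume "x \<in> centralizer R (A \<one>)"
    then have x: "x \<in> carrier R" "\<And>a. a \<in> A \<one> \<Longrightarrow> x \<otimes>\<^bsub>R\<^esub> a = a \<otimes>\<^bsub>R\<^esub> x"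
      by (auto simp: centralizer_def)
    have "g = \<one>" if g: "g \<in> supp x" for g
    proof -
      let ?c = "proj g x"
      have gG: "g \<in> carrier G"
        using g supp_subset by blast
      have c: "?c \<in> A g" "?c \<in> carrier R" "?c \<noteq> \<zero>\<^bsub>R\<^esub>"
        using g x gG by (auto simp: proj_in proj_in_carrier supp_def)
      have comm: "?c \<otimes>\<^bsub>R\<^esub> a = a \<otimes>\<^bsub>R\<^esub> ?c" if "a \<in> A \<one>" for a
        using proj_mult_left[of \<one> g a x] proj_mult_right[of g a x] that x gG by simp
      note A1 = component_in_carrier[OF G.one_closed]
      have "(\<lambda>a. a \<otimes>\<^bsub>R\<^esub> ?c) \<in> hom_parts (A \<one>) (A g)"
        using component_mult_closed[of \<one> g] gG c A1
        by (intro bimodule_homI) (auto simp: R.l_distr R.m_assoc comm)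
      then have "\<one> = g"
        using nonisomorphic_componentsD[OF sim noniso G.one_closed gG _ one_in_component] c by simp
      then show ?thesis ..
    qed
    then have "x \<in> graded_part R A {\<one>}"
      using x by (auto simp: graded_part_iff)
    then show "x \<in> center Re"
      using x by (simp add: graded_part_singleton center_def centralizer_def)
  qed
qed

end

context strongly_graded_ring
begin

text \<open>Strong gradation enters the proof through this writing of the unit, which acts like a dual
  basis of \<open>A g\<close>.\<close>

lemma one_decomposition:
  assumes "g \<in> carrier G"
  obtains n :: nat and u v where "\<And>i. i < n \<Longrightarrow> u i \<in> A (inv g)" "\<And>i. i < n \<Longrightarrow> v i \<in> A g"
    "\<one>\<^bsub>R\<^esub> = (\<Oplus>\<^bsub>R\<^esub>i\<in>{..<n}. u i \<otimes>\<^bsub>R\<^esub> v i)"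
proof -
  have "\<one>\<^bsub>R\<^esub> \<in> set_prod R (A (inv g)) (A g)"
    using component_mult_eq[of "inv g" g] assms one_in_component by simp
  then show ?thesis
    unfolding set_prod_def using that by blast
qed

text \<open>With \<open>1 = \<Sum> u\<^sub>i v\<^sub>i\<close> and all \<open>v\<^sub>i\<close> in \<open>A g\<close>, every \<open>y\<close> is recovered as \<open>\<Sum> u\<^sub>i (v\<^sub>i y)\<close>.\<close>

lemma component_cancel_left:
  assumes g: "g \<in> carrier G" and y: "y \<in> carrier R" "z \<in> carrier R"
    and eq: "\<And>x. x \<in> A g \<Longrightarrow> x \<otimes>\<^bsub>R\<^esub> y = x \<otimes>\<^bsub>R\<^esub> z"
  shows "y = z"
proof -
  obtain n :: nat and u v where u: "\<And>i. i < n \<Longrightarrow> u i \<in> A (inv g)" and v: "\<And>i. i < n \<Longrightarrow> v i \<in> A g"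
    and one: "\<one>\<^bsub>R\<^esub> = (\<Oplus>\<^bsub>R\<^esub>i\<in>{..<n}. u i \<otimes>\<^bsub>R\<^esub> v i)"
    using one_decomposition[OF g] by blast
  have uc: "u i \<in> carrier R" and vc: "v i \<in> carrier R" if "i < n" for i
    using component_in_carrier[OF _ u[OF that]] component_in_carrier[OF g v[OF that]] g by auto
  have expand: "w = (\<Oplus>\<^bsub>R\<^esub>i\<in>{..<n}. u i \<otimes>\<^bsub>R\<^esub> (v i \<otimes>\<^bsub>R\<^esub> w))" if w: "w \<in> carrier R" for w
  proof -
    have "w = (\<Oplus>\<^bsub>R\<^esub>i\<in>{..<n}. u i \<otimes>\<^bsub>R\<^esub> v i) \<otimes>\<^bsub>R\<^esub> w"
      using w by (simp flip: one)
    also have "\<dots> = (\<Oplus>\<^bsub>R\<^esub>i\<in>{..<n}. u i \<otimes>\<^bsub>R\<^esub> v i \<otimes>\<^bsub>R\<^esub> w)"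
      using uc vc w by (intro R.finsum_ldistr) auto
    also have "\<dots> = (\<Oplus>\<^bsub>R\<^esub>i\<in>{..<n}. u i \<otimes>\<^bsub>R\<^esub> (v i \<otimes>\<^bsub>R\<^esub> w))"
      using uc vc w by (intro R.finsum_cong') (auto simp: R.m_assoc)
    finally show ?thesis .
  qed
  have "(\<Oplus>\<^bsub>R\<^esub>i\<in>{..<n}. u i \<otimes>\<^bsub>R\<^esub> (v i \<otimes>\<^bsub>R\<^esub> y)) = (\<Oplus>\<^bsub>R\<^esub>i\<in>{..<n}. u i \<otimes>\<^bsub>R\<^esub> (v i \<otimes>\<^bsub>R\<^esub> z))"
    using uc vc v y eq by (intro R.finsum_cong') auto
  with expand[OF y(1)] expand[OF y(2)] show ?thesis
    by simp
qed

text \<open>An isomorphism \<open>f\<close> from \<open>A g\<close> to \<open>A h\<close> is right multiplication by the element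
  \<open>c = \<Sum> u\<^sub>i f(v\<^sub>i)\<close> of degree \<open>g\<inverse>h\<close>, where \<open>1 = \<Sum> u\<^sub>i v\<^sub>i\<close> as above. Linearity of \<open>f\<close> on the right
  gives \<open>x (c a) = x (a c)\<close> for all \<open>x\<close> in \<open>A g\<close>, so \<open>c\<close> centralizes the identity component; under the
  hypothesis on the centralizer, \<open>c\<close> then has degree \<open>\<one>\<close>.\<close>

lemma isomorphic_components_eq:
  assumes sim: "simple_components" and cent: "centralizer R (A \<one>) = center Re"
    and g: "g \<in> carrier G" and h: "h \<in> carrier G" and iso: "isomorphic_parts (A g) (A h)"
  shows "g = h"
proof -
  obtain f where f: "f \<in> hom_parts (A g) (A h)" and bij: "bij_betw f (A g) (A h)"
    using iso by (auto simp: isomorphic_parts_iff)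
  note fD = hom_partsD[OF f]
  obtain n :: nat and u v where u: "\<And>i. i < n \<Longrightarrow> u i \<in> A (inv g)" and v: "\<And>i. i < n \<Longrightarrow> v i \<in> A g"
    and one: "\<one>\<^bsub>R\<^esub> = (\<Oplus>\<^bsub>R\<^esub>i\<in>{..<n}. u i \<otimes>\<^bsub>R\<^esub> v i)"
    using one_decomposition[OF g] by blast
  have uc: "u i \<in> carrier R" and vc: "v i \<in> carrier R" and fvc: "f (v i) \<in> carrier R" if "i < n" for i
    using component_in_carrier[OF _ u[OF that]] component_in_carrier[OF g v[OF that]]
      component_in_carrier[OF h fD(1)[OF v[OF that]]] g by auto
  define c where "c = (\<Oplus>\<^bsub>R\<^esub>i\<in>{..<n}. u i \<otimes>\<^bsub>R\<^esub> f (v i))"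
  have c: "c \<in> A (inv g \<otimes> h)"
    unfolding c_def using g h u v fD(1)
    by (intro stable_finsum component_stable) (auto intro!: component_mult_closed)
  then have cc: "c \<in> carrier R"
    using component_in_carrier[OF _ c] g h by simp
  have fc: "x \<otimes>\<^bsub>R\<^esub> c = f x" if x: "x \<in> A g" for x
  proof -
    have xc: "x \<in> carrier R"
      using x g component_in_carrier by blast
    have xu: "x \<otimes>\<^bsub>R\<^esub> u i \<in> A \<one>" if "i < n" for i
      using component_mult_closed[OF g _ x u[OF that]] g by simp
    have "x \<otimes>\<^bsub>R\<^esub> c = (\<Oplus>\<^bsub>R\<^esub>i\<in>{..<n}. x \<otimes>\<^bsub>R\<^esub> (u i \<otimes>\<^bsub>R\<^esub> f (v i)))"
      unfolding c_def using uc fvc xc by (intro R.finsum_rdistr) auto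
    also have "\<dots> = (\<Oplus>\<^bsub>R\<^esub>i\<in>{..<n}. f (x \<otimes>\<^bsub>R\<^esub> u i \<otimes>\<^bsub>R\<^esub> v i))"
      using uc fvc xc xu v by (intro R.finsum_cong') (auto simp: fD R.m_assoc)
    also have "\<dots> = f (\<Oplus>\<^bsub>R\<^esub>i\<in>{..<n}. x \<otimes>\<^bsub>R\<^esub> u i \<otimes>\<^bsub>R\<^esub> v i)"
      using component_mult_closed[OF G.one_closed g] xu v g
      by (intro hom_parts_finsum[OF component_stable[OF g] component_stable[OF h] f, symmetric]) auto
    also have "(\<Oplus>\<^bsub>R\<^esub>i\<in>{..<n}. x \<otimes>\<^bsub>R\<^esub> u i \<otimes>\<^bsub>R\<^esub> v i) = (\<Oplus>\<^bsub>R\<^esub>i\<in>{..<n}. x \<otimes>\<^bsub>R\<^esub> (u i \<otimes>\<^bsub>R\<^esub> v i))"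
      using uc vc xc by (intro R.finsum_cong') (auto simp: R.m_assoc)
    also have "\<dots> = x \<otimes>\<^bsub>R\<^esub> (\<Oplus>\<^bsub>R\<^esub>i\<in>{..<n}. u i \<otimes>\<^bsub>R\<^esub> v i)"
      using uc vc xc by (intro R.finsum_rdistr[symmetric]) auto
    also have "\<dots> = x"
      using xc by (simp flip: one)
    finally show ?thesis .
  qed
  have "c \<otimes>\<^bsub>R\<^esub> a = a \<otimes>\<^bsub>R\<^esub> c" if a: "a \<in> A \<one>" for a
  proof (rule component_cancel_left[OF g])
    have ac: "a \<in> carrier R"
      using a component_in_carrier by blast
    then show "c \<otimes>\<^bsub>R\<^esub> a \<in> carrier R" "a \<otimes>\<^bsub>R\<^esub> c \<in> carrier R"
      using cc by auto
    fix x assume x: "x \<in> A g"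
    then have xc: "x \<in> carrier R" and xa: "x \<otimes>\<^bsub>R\<^esub> a \<in> A g"
      using g a component_in_carrier component_mult_closed[of g \<one> x a] by auto
    have "x \<otimes>\<^bsub>R\<^esub> (c \<otimes>\<^bsub>R\<^esub> a) = f x \<otimes>\<^bsub>R\<^esub> a"
      using xc cc ac by (simp add: fc x flip: R.m_assoc)
    also have "\<dots> = x \<otimes>\<^bsub>R\<^esub> a \<otimes>\<^bsub>R\<^esub> c"
      using fD(4)[OF a x] fc[OF xa] by simp
    finally show "x \<otimes>\<^bsub>R\<^esub> (c \<otimes>\<^bsub>R\<^esub> a) = x \<otimes>\<^bsub>R\<^esub> (a \<otimes>\<^bsub>R\<^esub> c)"
      using xc cc ac by (simp add: R.m_assoc)
  qed
  then have "c \<in> centralizer R (A \<one>)"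
    using cc by (simp add: centralizer_def)
  then have "c \<in> A \<one>"
    unfolding cent by (simp add: center_def centralizer_def)
  moreover have "c \<noteq> \<zero>\<^bsub>R\<^esub>"
  proof
    assume "c = \<zero>\<^bsub>R\<^esub>"
    then have "f x = \<zero>\<^bsub>R\<^esub>" if "x \<in> A g" for x
      using fc[OF that] component_in_carrier[OF g that] by simp
    moreover obtain y where "y \<in> A h" "y \<noteq> \<zero>\<^bsub>R\<^esub>"
      using simple_components_nonzero[OF sim h] .
    ultimately show False
      using bij unfolding bij_betw_def by (metis imageE)
  qed
  ultimately have "inv g \<otimes> h = \<one>"
    using component_inter[of "inv g \<otimes> h" \<one> c] c g h by auto
  then have "g \<otimes> (inv g \<otimes> h) = g"
    using g by simp
  then show ?thesis
    using g h by (simp flip: G.m_assoc)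
qed

end


section \<open>Tensor products\<close>

locale balanced_pairing = M: bimodule T M + N: bimodule T N + L: bimodule T L
  for T :: "('a, 'c) ring_scheme" and M :: "('a, 'm, 'x) bimodule_scheme"
    and N :: "('a, 'n, 'y) bimodule_scheme" and L :: "('a, 'l, 'z) bimodule_scheme" +
  fixes p :: "'m \<Rightarrow> 'n \<Rightarrow> 'l"
  assumes pairing_closed: "\<lbrakk>x \<in> carrier M; y \<in> carrier N\<rbrakk> \<Longrightarrow> p x y \<in> carrier L"
    and pairing_add_left: "\<lbrakk>x \<in> carrier M; x' \<in> carrier M; y \<in> carrier N\<rbrakk> \<Longrightarrow>
      p (x \<oplus>\<^bsub>M\<^esub> x') y = p x y \<oplus>\<^bsub>L\<^esub> p x' y"
    and pairing_add_right: "\<lbrakk>x \<in> carrier M; y \<in> carrier N; y' \<in> carrier N\<rbrakk> \<Longrightarrow>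
      p x (y \<oplus>\<^bsub>N\<^esub> y') = p x y \<oplus>\<^bsub>L\<^esub> p x y'"
    and pairing_balanced: "\<lbrakk>a \<in> carrier T; x \<in> carrier M; y \<in> carrier N\<rbrakk> \<Longrightarrow>
      p (x \<odot>\<^sub>r\<^bsub>M\<^esub> a) y = p x (a \<odot>\<^bsub>N\<^esub> y)"
    and pairing_smult: "\<lbrakk>a \<in> carrier T; x \<in> carrier M; y \<in> carrier N\<rbrakk> \<Longrightarrow>
      p (a \<odot>\<^bsub>M\<^esub> x) y = a \<odot>\<^bsub>L\<^esub> p x y"
    and pairing_rsmult: "\<lbrakk>a \<in> carrier T; x \<in> carrier M; y \<in> carrier N\<rbrakk> \<Longrightarrow>
      p x (y \<odot>\<^sub>r\<^bsub>N\<^esub> a) = p x y \<odot>\<^sub>r\<^bsub>L\<^esub> a"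
begin

abbreviation F where "F \<equiv> tensor_group M N"
abbreviation K where "K \<equiv> tensor_relations T M N"

lemma carrier_F: "c \<in> carrier F \<longleftrightarrow> Poly_Mapping.keys c \<subseteq> carrier M \<times> carrier N"
  by (simp add: tensor_group_def)

lemma frag_of_in_F: "\<lbrakk>x \<in> carrier M; y \<in> carrier N\<rbrakk> \<Longrightarrow> frag_of (x, y) \<in> carrier F"
  by (simp add: carrier_F)

lemma group_F: "group F"
  by (simp add: tensor_group_def)

lemma F_simps [simp]: "c \<otimes>\<^bsub>F\<^esub> d = c + d" "\<one>\<^bsub>F\<^esub> = 0"
  by (simp_all add: tensor_group_def)

lemma inv_F: "c \<in> carrier F \<Longrightarrow> inv\<^bsub>F\<^esub> c = - c"
  by (simp add: tensor_group_def)

lemma diff_in_F: "\<lbrakk>c \<in> carrier F; d \<in> carrier F\<rbrakk> \<Longrightarrow> c - d \<in> carrier F"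
  using keys_diff[of c d] by (auto simp: carrier_F)

lemma relations_in_K:
  shows "\<lbrakk>x \<in> carrier M; x' \<in> carrier M; y \<in> carrier N\<rbrakk> \<Longrightarrow>
      frag_of (x \<oplus>\<^bsub>M\<^esub> x', y) - frag_of (x, y) - frag_of (x', y) \<in> K"
    and "\<lbrakk>x \<in> carrier M; y \<in> carrier N; y' \<in> carrier N\<rbrakk> \<Longrightarrow>
      frag_of (x, y \<oplus>\<^bsub>N\<^esub> y') - frag_of (x, y) - frag_of (x, y') \<in> K"
    and "\<lbrakk>a \<in> carrier T; x \<in> carrier M; y \<in> carrier N\<rbrakk> \<Longrightarrow>
      frag_of (x \<odot>\<^sub>r\<^bsub>M\<^esub> a, y) - frag_of (x, a \<odot>\<^bsub>N\<^esub> y) \<in> K"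
  unfolding tensor_relations_def by (rule generate.incl, blast)+

lemma subgroup_K: "subgroup K F"
  unfolding tensor_relations_def
  by (rule group.generate_is_subgroup[OF group_F])
     (auto intro!: diff_in_F frag_of_in_F M.M.a_closed N.M.a_closed M.rsmult_closed N.smult_closed)

lemma K_closed:
  shows "0 \<in> K" "\<lbrakk>c \<in> K; d \<in> K\<rbrakk> \<Longrightarrow> c + d \<in> K" "c \<in> K \<Longrightarrow> - c \<in> K" "\<lbrakk>c \<in> K; d \<in> K\<rbrakk> \<Longrightarrow> c - d \<in> K"
proof -
  show zero: "0 \<in> K"
    using subgroup.one_closed[OF subgroup_K] by simp
  show add: "c + d \<in> K" if "c \<in> K" "d \<in> K" for c d
    using subgroup.m_closed[OF subgroup_K that] by simp
  show uminus: "- c \<in> K" if "c \<in> K" for c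
    using subgroup.m_inv_closed[OF subgroup_K that] subgroup.mem_carrier[OF subgroup_K that]
    by (simp add: inv_F)
  show "c - d \<in> K" if "c \<in> K" "d \<in> K"
    using add[OF that(1) uminus[OF that(2)]] by simp
qed

lemma K_sum: "(\<And>i. i \<in> I \<Longrightarrow> c i \<in> K) \<Longrightarrow> (\<Sum>i\<in>I. c i) \<in> K"
  by (induction I rule: infinite_finite_induct) (auto intro: K_closed)

context
  fixes h
  assumes h: "h \<in> hom F (add_monoid L)"
    and h_frag_of: "\<And>x y. \<lbrakk>x \<in> carrier M; y \<in> carrier N\<rbrakk> \<Longrightarrow> h (frag_of (x, y)) = p x y"
begin

interpretation h: group_hom F "add_monoid L" h
  using h group_F L.M.a_group by (simp add: group_hom_def group_hom_axioms_def)

lemma h_simps: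
  shows "c \<in> carrier F \<Longrightarrow> h c \<in> carrier L" "h 0 = \<zero>\<^bsub>L\<^esub>"
    and "\<lbrakk>c \<in> carrier F; d \<in> carrier F\<rbrakk> \<Longrightarrow> h (c + d) = h c \<oplus>\<^bsub>L\<^esub> h d"
    and "\<lbrakk>c \<in> carrier F; d \<in> carrier F\<rbrakk> \<Longrightarrow> h (c - d) = h c \<oplus>\<^bsub>L\<^esub> \<ominus>\<^bsub>L\<^esub> h d"
proof -
  show "h c \<in> carrier L" if "c \<in> carrier F"
    using h.hom_closed[OF that] by simp
  show "h 0 = \<zero>\<^bsub>L\<^esub>"
    using h.hom_one by simp
  show "h (c + d) = h c \<oplus>\<^bsub>L\<^esub> h d" if "c \<in> carrier F" "d \<in> carrier F" for c d
    using h.hom_mult[OF that] by simp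
  from this[of c "- d"] show "h (c - d) = h c \<oplus>\<^bsub>L\<^esub> \<ominus>\<^bsub>L\<^esub> h d"
    if "c \<in> carrier F" "d \<in> carrier F"
    using that h.hom_inv[of d] group.inv_closed[OF group_F, of d] by (simp add: inv_F a_inv_def)
qed

lemma h_sum:
  assumes "finite I" "\<And>i. i \<in> I \<Longrightarrow> c i \<in> carrier F"
  shows "(\<Sum>i\<in>I. c i) \<in> carrier F \<and> h (\<Sum>i\<in>I. c i) = (\<Oplus>\<^bsub>L\<^esub>i\<in>I. h (c i))"
  using assms
proof (induction I rule: finite_induct)
  case empty
  then show ?case
    using group.is_monoid[OF group_F, THEN monoid.one_closed] by (simp add: h_simps)
next
  case (insert i I)
  then have "(\<Oplus>\<^bsub>L\<^esub>j\<in>insert i I. h (c j)) = h (c i) \<oplus>\<^bsub>L\<^esub> (\<Oplus>\<^bsub>L\<^esub>j\<in>I. h (c j))"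
    by (intro L.M.finsum_insert) (auto intro: h_simps)
  moreover have "c i + (\<Sum>j\<in>I. c j) \<in> carrier F"
    using monoid.m_closed[OF group.is_monoid[OF group_F], of "c i" "\<Sum>j\<in>I. c j"] insert by simp
  ultimately show ?case
    using insert by (simp add: h_simps)
qed

lemma K_subset_kernel: "K \<subseteq> kernel F (add_monoid L) h"
  unfolding tensor_relations_def
proof (rule group.generate_subgroup_incl[OF group_F _ h.subgroup_kernel])
  note closed = pairing_closed M.M.a_closed N.M.a_closed M.rsmult_closed N.smult_closed
    diff_in_F frag_of_in_F
  have cancel: "a \<oplus>\<^bsub>L\<^esub> b \<oplus>\<^bsub>L\<^esub> \<ominus>\<^bsub>L\<^esub> a \<oplus>\<^bsub>L\<^esub> \<ominus>\<^bsub>L\<^esub> b = \<zero>\<^bsub>L\<^esub>"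
    if "a \<in> carrier L" "b \<in> carrier L" for a b
  proof -
    have "a \<oplus>\<^bsub>L\<^esub> b \<oplus>\<^bsub>L\<^esub> \<ominus>\<^bsub>L\<^esub> a = b"
      using that by (simp add: L.M.a_comm[of a b] L.M.a_assoc L.M.r_neg)
    then show ?thesis
      using that by (simp add: L.M.r_neg)
  qed
  let ?ker = "kernel F (add_monoid L) h"
  have "frag_of (x \<oplus>\<^bsub>M\<^esub> x', y) - frag_of (x, y) - frag_of (x', y) \<in> ?ker"
    if "x \<in> carrier M" "x' \<in> carrier M" "y \<in> carrier N" for x x' y
    using that by (simp add: kernel_def closed h_simps h_frag_of pairing_add_left cancel)
  moreover have "frag_of (x, y \<oplus>\<^bsub>N\<^esub> y') - frag_of (x, y) - frag_of (x, y') \<in> ?ker"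
    if "x \<in> carrier M" "y \<in> carrier N" "y' \<in> carrier N" for x y y'
    using that by (simp add: kernel_def closed h_simps h_frag_of pairing_add_right cancel)
  moreover have "frag_of (x \<odot>\<^sub>r\<^bsub>M\<^esub> a, y) - frag_of (x, a \<odot>\<^bsub>N\<^esub> y) \<in> ?ker"
    if "a \<in> carrier T" "x \<in> carrier M" "y \<in> carrier N" for a x y
    using that by (simp add: kernel_def closed h_simps h_frag_of pairing_balanced L.M.r_neg)
  ultimately show "{frag_of (x \<oplus>\<^bsub>M\<^esub> x', y) - frag_of (x, y) - frag_of (x', y) | x x' y.
        x \<in> carrier M \<and> x' \<in> carrier M \<and> y \<in> carrier N} \<union>
     {frag_of (x, y \<oplus>\<^bsub>N\<^esub> y') - frag_of (x, y) - frag_of (x, y') | x y y'.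
        x \<in> carrier M \<and> y \<in> carrier N \<and> y' \<in> carrier N} \<union>
     {frag_of (x \<odot>\<^sub>r\<^bsub>M\<^esub> a, y) - frag_of (x, a \<odot>\<^bsub>N\<^esub> y) | a x y.
        a \<in> carrier T \<and> x \<in> carrier M \<and> y \<in> carrier N} \<subseteq> ?ker"
    by blast
qed

text \<open>The induced homomorphism on the tensor product is injective as soon as an additive map
  \<open>\<sigma>\<close> into the tensor product takes each \<open>p x y\<close> back to the class of \<open>(x, y)\<close>: these
  classes generate, so \<open>\<sigma>\<close> is then a left inverse.\<close>

lemma kernel_eq_K:
  assumes \<sigma>_add: "\<And>z z'. \<lbrakk>z \<in> carrier L; z' \<in> carrier L\<rbrakk> \<Longrightarrow> \<sigma> (z \<oplus>\<^bsub>L\<^esub> z') - \<sigma> z - \<sigma> z' \<in> K"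
    and \<sigma>_pairing: "\<And>x y. \<lbrakk>x \<in> carrier M; y \<in> carrier N\<rbrakk> \<Longrightarrow> \<sigma> (p x y) - frag_of (x, y) \<in> K"
  shows "kernel F (add_monoid L) h = K"
proof
  have \<sigma>_zero: "\<sigma> \<zero>\<^bsub>L\<^esub> \<in> K"
    using K_closed(3)[OF \<sigma>_add[of "\<zero>\<^bsub>L\<^esub>" "\<zero>\<^bsub>L\<^esub>"]] by simp
  have \<sigma>_diff: "\<sigma> (z \<oplus>\<^bsub>L\<^esub> \<ominus>\<^bsub>L\<^esub> z') - (\<sigma> z - \<sigma> z') \<in> K" if "z \<in> carrier L" "z' \<in> carrier L" for z z'
  proof -
    have "\<sigma> (z \<oplus>\<^bsub>L\<^esub> \<ominus>\<^bsub>L\<^esub> z' \<oplus>\<^bsub>L\<^esub> z') - \<sigma> (z \<oplus>\<^bsub>L\<^esub> \<ominus>\<^bsub>L\<^esub> z') - \<sigma> z' \<in> K"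
      using that by (intro \<sigma>_add) auto
    moreover have "z \<oplus>\<^bsub>L\<^esub> \<ominus>\<^bsub>L\<^esub> z' \<oplus>\<^bsub>L\<^esub> z' = z"
      using that by (simp add: L.M.a_assoc L.M.l_neg)
    ultimately have "\<sigma> z - \<sigma> (z \<oplus>\<^bsub>L\<^esub> \<ominus>\<^bsub>L\<^esub> z') - \<sigma> z' \<in> K"
      by simp
    from K_closed(3)[OF this] have "- (\<sigma> z - \<sigma> (z \<oplus>\<^bsub>L\<^esub> \<ominus>\<^bsub>L\<^esub> z') - \<sigma> z') \<in> K" .
    then show ?thesis
      by (simp add: algebra_simps)
  qed
  have inverse: "c \<in> carrier F \<and> \<sigma> (h c) - c \<in> K" if "Poly_Mapping.keys c \<subseteq> carrier M \<times> carrier N" for c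
    using that
  proof (induction c rule: frag_induction)
    case zero
    then show ?case
      using \<sigma>_zero by (simp add: h_simps carrier_F)
  next
    case (one q)
    then show ?case
      using \<sigma>_pairing by (auto simp: h_frag_of frag_of_in_F)
  next
    case (diff a b)
    then have "\<sigma> (h a \<oplus>\<^bsub>L\<^esub> \<ominus>\<^bsub>L\<^esub> h b) - (\<sigma> (h a) - \<sigma> (h b)) \<in> K"
      by (intro \<sigma>_diff) (auto intro: h_simps)
    then have "\<sigma> (h a \<oplus>\<^bsub>L\<^esub> \<ominus>\<^bsub>L\<^esub> h b) - (\<sigma> (h a) - \<sigma> (h b)) + ((\<sigma> (h a) - a) - (\<sigma> (h b) - b)) \<in> K"
      using diff by (blast intro: K_closed(2,4))
    moreover have "\<sigma> (h a \<oplus>\<^bsub>L\<^esub> \<ominus>\<^bsub>L\<^esub> h b) - (\<sigma> (h a) - \<sigma> (h b)) + ((\<sigma> (h a) - a) - (\<sigma> (h b) - b))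
        = \<sigma> (h (a - b)) - (a - b)"
      using diff by (simp add: h_simps)
    ultimately show ?case
      using diff diff_in_F by simp
  qed
  show "kernel F (add_monoid L) h \<subseteq> K"
  proof
    fix c assume "c \<in> kernel F (add_monoid L) h"
    then have "c \<in> carrier F" "h c = \<zero>\<^bsub>L\<^esub>"
      by (auto simp: kernel_def)
    then have "\<sigma> \<zero>\<^bsub>L\<^esub> - c \<in> K"
      using inverse[of c] by (simp add: carrier_F)
    from K_closed(4)[OF \<sigma>_zero this] have "\<sigma> \<zero>\<^bsub>L\<^esub> - (\<sigma> \<zero>\<^bsub>L\<^esub> - c) \<in> K" .
    then show "c \<in> K"
      by simp
  qed
qed (rule K_subset_kernel)

text \<open>Both directions of the isomorphism are recorded: the second one contains the fact that the
  actions on the tensor product are closed, and with both at hand a tensor product and \<open>L\<close> have the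
  same isomorphism class.\<close>

lemma tensor_isomorphic_if_kernel:
  assumes surj: "h ` carrier F = carrier L" and ker: "kernel F (add_monoid L) h = K"
  shows "bimodule_isomorphic T (tensor T M N) L \<and> bimodule_isomorphic T L (tensor T M N)"
proof -
  define \<theta> where "\<theta> = (\<lambda>P. the_elem (h ` P))"
  have iso: "\<theta> \<in> iso (F Mod K) (add_monoid L)"
    using h.FactGroup_iso_set surj unfolding ker \<theta>_def by simp
  have coset: "K #>\<^bsub>F\<^esub> c = {d \<in> carrier F. h d = h c}" if c: "c \<in> carrier F" for c
  proof (intro subset_antisym subsetI)
    fix d assume "d \<in> K #>\<^bsub>F\<^esub> c"
    then obtain k where "k \<in> K" "d = k + c"
      by (auto simp: r_coset_def)
    moreover from this have "k \<in> carrier F" "h k = \<zero>\<^bsub>L\<^esub>"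
      by (auto simp: kernel_def simp flip: ker)
    ultimately show "d \<in> {d \<in> carrier F. h d = h c}"
      using c monoid.m_closed[OF group.is_monoid[OF group_F], of k c] by (simp add: h_simps)
  next
    fix d assume d: "d \<in> {d \<in> carrier F. h d = h c}"
    then have "d - c \<in> K"
      using c by (simp add: kernel_def h_simps diff_in_F L.M.r_neg flip: ker)
    then show "d \<in> K #>\<^bsub>F\<^esub> c"
      unfolding r_coset_def by (auto intro!: bexI[of _ "d - c"])
  qed
  have \<theta>: "\<theta> (K #>\<^bsub>F\<^esub> c) = h c" if "c \<in> carrier F" for c
  proof -
    have "h ` (K #>\<^bsub>F\<^esub> c) = {h c}"
      using that by (auto simp: coset)
    then show ?thesis
      by (simp add: \<theta>_def)
  qed
  \<comment> \<open>The two actions are unions over all representatives of a coset; the representatives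
    contribute the same coset whenever \<open>h\<close> carries the action on \<open>F\<close> to an operation \<open>r\<close> on \<open>L\<close>.\<close>
  have action: "(\<Union>c\<in>P. K #>\<^bsub>F\<^esub> frag_extend t c) \<in> carrier (F Mod K) \<and>
      \<theta> (\<Union>c\<in>P. K #>\<^bsub>F\<^esub> frag_extend t c) = r (\<theta> P)"
    if P: "P \<in> carrier (F Mod K)"
      and t: "\<And>q. q \<in> carrier M \<times> carrier N \<Longrightarrow> t q \<in> carrier F \<and> h (t q) = r (h (frag_of q))"
      and r: "\<And>z z'. \<lbrakk>z \<in> carrier L; z' \<in> carrier L\<rbrakk> \<Longrightarrow> r (z \<oplus>\<^bsub>L\<^esub> z') = r z \<oplus>\<^bsub>L\<^esub> r z'"
      and rc: "\<And>z. z \<in> carrier L \<Longrightarrow> r z \<in> carrier L"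
    for P t r
  proof -
    have r0: "r \<zero>\<^bsub>L\<^esub> = \<zero>\<^bsub>L\<^esub>"
      using r[of "\<zero>\<^bsub>L\<^esub>" "\<zero>\<^bsub>L\<^esub>"] rc[of "\<zero>\<^bsub>L\<^esub>"] by (simp add: L.M.add.l_cancel_one)
    have rm: "r (\<ominus>\<^bsub>L\<^esub> z) = \<ominus>\<^bsub>L\<^esub> r z" if "z \<in> carrier L" for z
      using r[of "\<ominus>\<^bsub>L\<^esub> z" z] rc[of z] rc[of "\<ominus>\<^bsub>L\<^esub> z"] r0 that
      by (simp add: L.M.l_neg L.M.minus_equality)
    have ext: "c \<in> carrier F \<and> frag_extend t c \<in> carrier F \<and> h (frag_extend t c) = r (h c)"
      if "Poly_Mapping.keys c \<subseteq> carrier M \<times> carrier N" for c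
      using that
    proof (induction c rule: frag_induction)
      case zero
      then show ?case
        by (simp add: carrier_F h_simps r0)
    next
      case (one q)
      then show ?case
        using t[of q] by (auto simp: carrier_F)
    next
      case (diff a b)
      then show ?case
        by (simp add: frag_extend_diff diff_in_F h_simps r rm L.M.a_inv_closed)
    qed
    obtain c where c: "c \<in> carrier F" "P = K #>\<^bsub>F\<^esub> c"
      using P by (auto simp: FactGroup_def RCOSETS_def)
    have "K #>\<^bsub>F\<^esub> frag_extend t d = K #>\<^bsub>F\<^esub> frag_extend t c" if "d \<in> P" for d
      using that ext[of c] ext[of d] c by (auto simp: coset carrier_F)
    moreover have "c \<in> P"
      using c by (simp add: coset)
    ultimately have "(\<Union>d\<in>P. K #>\<^bsub>F\<^esub> frag_extend t d) = K #>\<^bsub>F\<^esub> frag_extend t c"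
      by blast
    then show ?thesis
      using c ext[of c] by (simp add: \<theta> carrier_F carrier_FactGroup)
  qed
  have carrier: "carrier (tensor T M N) = carrier (F Mod K)"
    by (simp add: tensor_def Let_def)
  have left: "a \<odot>\<^bsub>tensor T M N\<^esub> P \<in> carrier (F Mod K) \<and>
      \<theta> (a \<odot>\<^bsub>tensor T M N\<^esub> P) = a \<odot>\<^bsub>L\<^esub> \<theta> P"
    if "a \<in> carrier T" "P \<in> carrier (F Mod K)" for a P
    using that action[of P "\<lambda>(x, y). frag_of (a \<odot>\<^bsub>M\<^esub> x, y)" "\<lambda>z. a \<odot>\<^bsub>L\<^esub> z"]
    by (auto simp: tensor_def Let_def frag_of_in_F h_frag_of pairing_smult L.smult_closed
        L.smult_r_distr M.smult_closed)
  have right: "P \<odot>\<^sub>r\<^bsub>tensor T M N\<^esub> a \<in> carrier (F Mod K) \<and>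
      \<theta> (P \<odot>\<^sub>r\<^bsub>tensor T M N\<^esub> a) = \<theta> P \<odot>\<^sub>r\<^bsub>L\<^esub> a"
    if "a \<in> carrier T" "P \<in> carrier (F Mod K)" for a P
    using that action[of P "\<lambda>(x, y). frag_of (x, y \<odot>\<^sub>r\<^bsub>N\<^esub> a)" "\<lambda>z. z \<odot>\<^sub>r\<^bsub>L\<^esub> a"]
    by (auto simp: tensor_def Let_def frag_of_in_F h_frag_of pairing_rsmult L.rsmult_closed
        L.rsmult_l_distr N.rsmult_closed)
  have add: "P \<oplus>\<^bsub>tensor T M N\<^esub> Q = P \<otimes>\<^bsub>F Mod K\<^esub> Q" for P Q
    by (simp add: tensor_def Let_def)
  have "group (F Mod K)"
    using normal.factorgroup_is_group[OF h.normal_kernel] unfolding ker .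
  note mult_closed = monoid.m_closed[OF group.is_monoid[OF this]]
  have hom: "\<theta> \<in> bimodule_hom T (tensor T M N) L"
    using iso left right by (intro bimodule_homI) (auto simp: carrier add iso_def hom_def)
  have bij: "bij_betw \<theta> (carrier (tensor T M N)) (carrier L)"
    using iso by (simp add: carrier iso_def)
  have "inv_into (carrier (tensor T M N)) \<theta> \<in> bimodule_hom T L (tensor T M N)"
    using left right mult_closed by (intro bimodule_hom_inverse hom bij) (simp_all add: carrier add)
  with hom bij show ?thesis
    unfolding bimodule_isomorphic_iff using bij_betw_inv_into[OF bij] by blast
qed

end

text \<open>The last hypothesis makes the induced homomorphism surjective; the two before it, through
  \<open>kernel_eq_K\<close>, make it injective.\<close>

lemma tensor_isomorphicI:
  assumes "\<And>z z'. \<lbrakk>z \<in> carrier L; z' \<in> carrier L\<rbrakk> \<Longrightarrow> \<sigma> (z \<oplus>\<^bsub>L\<^esub> z') - \<sigma> z - \<sigma> z' \<in> K"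
    and "\<And>x y. \<lbrakk>x \<in> carrier M; y \<in> carrier N\<rbrakk> \<Longrightarrow> \<sigma> (p x y) - frag_of (x, y) \<in> K"
    and sum: "\<And>z. z \<in> carrier L \<Longrightarrow> \<exists>(n :: nat) x y. x \<in> {..<n} \<rightarrow> carrier M \<and> y \<in> {..<n} \<rightarrow> carrier N \<and>
      z = (\<Oplus>\<^bsub>L\<^esub>i\<in>{..<n}. p (x i) (y i))"
  shows "bimodule_isomorphic T (tensor T M N) L \<and> bimodule_isomorphic T L (tensor T M N)"
proof -
  have "\<exists>h \<in> hom F (add_monoid L). \<forall>x \<in> carrier M. \<forall>y \<in> carrier N. h (frag_of (x, y)) = p x y"
  proof (rule comm_group.free_Abelian_group_universal[OF L.M.a_comm_group])
    show "(\<lambda>(x, y). p x y) ` (carrier M \<times> carrier N) \<subseteq> carrier (add_monoid L)"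
      using pairing_closed by auto
    fix h assume "h \<in> hom (free_Abelian_group (carrier M \<times> carrier N)) (add_monoid L)"
      and "\<And>q. q \<in> carrier M \<times> carrier N \<Longrightarrow> h (frag_of q) = (case q of (x, y) \<Rightarrow> p x y)"
    then show "\<exists>h \<in> hom F (add_monoid L). \<forall>x \<in> carrier M. \<forall>y \<in> carrier N. h (frag_of (x, y)) = p x y"
      by (intro bexI[of _ h]) (simp_all add: tensor_group_def)
  qed
  then obtain h where h: "h \<in> hom F (add_monoid L)"
    and frag': "\<forall>x \<in> carrier M. \<forall>y \<in> carrier N. h (frag_of (x, y)) = p x y"
    by (elim bexE)
  have frag: "h (frag_of (x, y)) = p x y" if "x \<in> carrier M" "y \<in> carrier N" for x y
    using frag' that by simp
  have "h ` carrier F = carrier L"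
  proof (intro subset_antisym subsetI)
    fix z assume "z \<in> carrier L"
    from sum[OF this] obtain n :: nat and x y where xy: "x \<in> {..<n} \<rightarrow> carrier M" "y \<in> {..<n} \<rightarrow> carrier N"
      and z: "z = (\<Oplus>\<^bsub>L\<^esub>i\<in>{..<n}. p (x i) (y i))"
      by (elim exE conjE)
    have "(\<Oplus>\<^bsub>L\<^esub>i\<in>{..<n}. h (frag_of (x i, y i))) = z"
      unfolding z using xy by (intro L.M.finsum_cong') (auto simp: Pi_iff frag pairing_closed)
    moreover have "(\<Sum>i<n. frag_of (x i, y i)) \<in> carrier F \<and>
        h (\<Sum>i<n. frag_of (x i, y i)) = (\<Oplus>\<^bsub>L\<^esub>i\<in>{..<n}. h (frag_of (x i, y i)))"
      using xy by (intro h_sum[OF h frag]) (auto intro: frag_of_in_F)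
    ultimately show "z \<in> h ` carrier F"
      by (intro image_eqI[of z h "\<Sum>i<n. frag_of (x i, y i)"]) simp_all
  next
    fix z assume "z \<in> h ` carrier F"
    then show "z \<in> carrier L"
      using h_simps(1)[OF h frag] by blast
  qed
  moreover have "kernel F (add_monoid L) h = K"
    by (rule kernel_eq_K[OF h frag assms(1,2)])
  ultimately show ?thesis
    using frag by (intro tensor_isomorphic_if_kernel[OF h])
qed

end


section \<open>The Picard homomorphism\<close>

context strongly_graded_ring
begin

text \<open>Multiplication in \<open>R\<close> induces the isomorphism of \<open>A g \<otimes> A h\<close> with \<open>A (g h)\<close>. With
  \<open>1 = \<Sum> u\<^sub>i v\<^sub>i\<close>, \<open>u\<^sub>i\<close> of degree \<open>h\<inverse>\<close> and \<open>v\<^sub>i\<close> of degree \<open>h\<close>, its inverse sends \<open>z\<close> to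
  \<open>\<Sum> z u\<^sub>i \<otimes> v\<^sub>i\<close>: indeed \<open>\<Sum> x y u\<^sub>i \<otimes> v\<^sub>i = \<Sum> x \<otimes> y u\<^sub>i v\<^sub>i = x \<otimes> y\<close>, because each \<open>y u\<^sub>i\<close> lies in
  the identity component. The statement is for arbitrary isomorphic copies \<open>M\<close>, \<open>N\<close> of the
  components, since the product in the Picard group ranges over all representatives.\<close>

lemma tensor_components:
  assumes M: "bimodule Re M" and N: "bimodule Re N"
    and g: "g \<in> carrier G" and h: "h \<in> carrier G"
    and isoM: "bimodule_isomorphic Re M (bimodule_in R (A g))"
    and isoN: "bimodule_isomorphic Re N (bimodule_in R (A h))"
  shows "bimodule_isomorphic Re (tensor Re M N) (bimodule_in R (A (g \<otimes> h))) \<and>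
    bimodule_isomorphic Re (bimodule_in R (A (g \<otimes> h))) (tensor Re M N)"
proof -
  interpret M: bimodule Re M by fact
  interpret N: bimodule Re N by fact
  obtain f where f: "f \<in> bimodule_hom Re M (bimodule_in R (A g))" and bijf: "bij_betw f (carrier M) (A g)"
    using isoM by (auto simp: bimodule_isomorphic_iff)
  obtain k where k: "k \<in> bimodule_hom Re N (bimodule_in R (A h))" and bijk: "bij_betw k (carrier N) (A h)"
    using isoN by (auto simp: bimodule_isomorphic_iff)
  define f' where "f' = inv_into (carrier M) f"
  define k' where "k' = inv_into (carrier N) k"
  have f': "f' \<in> bimodule_hom Re (bimodule_in R (A g)) M"
    unfolding f'_def using bijf by (intro bimodule_hom_inverse f bimodule_closed[OF M]) simp
  have k': "k' \<in> bimodule_hom Re (bimodule_in R (A h)) N"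
    unfolding k'_def using bijk by (intro bimodule_hom_inverse k bimodule_closed[OF N]) simp
  note fD = bimodule_homD[OF f, simplified] and kD = bimodule_homD[OF k, simplified]
    and f'D = bimodule_homD[OF f', simplified] and k'D = bimodule_homD[OF k', simplified]
  have ff': "f (f' z) = z" if "z \<in> A g" for z
    using bijf that by (simp add: f'_def bij_betw_def f_inv_into_f)
  have f'f: "f' (f x) = x" if "x \<in> carrier M" for x
    using bijf that by (simp add: f'_def bij_betw_def)
  have kk': "k (k' z) = z" if "z \<in> A h" for z
    using bijk that by (simp add: k'_def bij_betw_def f_inv_into_f)
  have k'k: "k' (k x) = x" if "x \<in> carrier N" for x
    using bijk that by (simp add: k'_def bij_betw_def)
  have Ac: "x \<in> carrier R" if "x \<in> A \<one>" for x
    using that component_in_carrier by blast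
  have fc: "f x \<in> carrier R" if "x \<in> carrier M" for x
    using that fD(1) component_in_carrier[OF g] by blast
  have kc: "k y \<in> carrier R" if "y \<in> carrier N" for y
    using that kD(1) component_in_carrier[OF h] by blast
  have gh: "g \<otimes> h \<in> carrier G"
    using g h by simp
  have L: "bimodule Re (bimodule_in R (A (g \<otimes> h)))"
    using component_stable[OF gh] bimodule_in_iff component_closed(1)[OF gh] by blast
  interpret balanced_pairing Re M N "bimodule_in R (A (g \<otimes> h))" "\<lambda>x y. f x \<otimes>\<^bsub>R\<^esub> k y"
    using fD kD fc kc Ac component_mult_closed[OF g h]
    by (intro balanced_pairing.intro M N L balanced_pairing_axioms.intro)
       (simp_all add: R.l_distr R.r_distr R.m_assoc)
  obtain n :: nat and u v where u: "\<And>i. i < n \<Longrightarrow> u i \<in> A (inv h)" and v: "\<And>i. i < n \<Longrightarrow> v i \<in> A h"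
    and one: "\<one>\<^bsub>R\<^esub> = (\<Oplus>\<^bsub>R\<^esub>i\<in>{..<n}. u i \<otimes>\<^bsub>R\<^esub> v i)"
    using one_decomposition[OF h] by blast
  have uc: "u i \<in> carrier R" and vc: "v i \<in> carrier R" if "i < n" for i
    using component_in_carrier[OF _ u[OF that]] component_in_carrier[OF h v[OF that]] h by auto
  have zu: "z \<otimes>\<^bsub>R\<^esub> u i \<in> A g" if "z \<in> A (g \<otimes> h)" "i < n" for z i
    using component_mult_closed[OF gh _ that(1) u[OF that(2)]] g h by (simp add: G.m_assoc)
  have split: "z = (\<Oplus>\<^bsub>R\<^esub>i\<in>{..<n}. z \<otimes>\<^bsub>R\<^esub> u i \<otimes>\<^bsub>R\<^esub> v i)" if z: "z \<in> carrier R" for z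
  proof -
    have "z = z \<otimes>\<^bsub>R\<^esub> (\<Oplus>\<^bsub>R\<^esub>i\<in>{..<n}. u i \<otimes>\<^bsub>R\<^esub> v i)"
      using z by (simp flip: one)
    also have "\<dots> = (\<Oplus>\<^bsub>R\<^esub>i\<in>{..<n}. z \<otimes>\<^bsub>R\<^esub> (u i \<otimes>\<^bsub>R\<^esub> v i))"
      using uc vc z by (intro R.finsum_rdistr) auto
    also have "\<dots> = (\<Oplus>\<^bsub>R\<^esub>i\<in>{..<n}. z \<otimes>\<^bsub>R\<^esub> u i \<otimes>\<^bsub>R\<^esub> v i)"
      using uc vc z by (intro R.finsum_cong') (auto simp: R.m_assoc)
    finally show ?thesis .
  qed
  define \<sigma> where "\<sigma> z = (\<Sum>i<n. frag_of (f' (z \<otimes>\<^bsub>R\<^esub> u i), k' (v i)))" for z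
  show ?thesis
  proof (rule tensor_isomorphicI[of \<sigma>])
    fix z z' assume z: "z \<in> carrier (bimodule_in R (A (g \<otimes> h)))" "z' \<in> carrier (bimodule_in R (A (g \<otimes> h)))"
    then have zc: "z \<in> carrier R" "z' \<in> carrier R"
      using component_in_carrier[OF gh] by auto
    have "\<sigma> (z \<oplus>\<^bsub>R\<^esub> z') - \<sigma> z - \<sigma> z' = (\<Sum>i<n. frag_of (f' ((z \<oplus>\<^bsub>R\<^esub> z') \<otimes>\<^bsub>R\<^esub> u i), k' (v i))
        - frag_of (f' (z \<otimes>\<^bsub>R\<^esub> u i), k' (v i)) - frag_of (f' (z' \<otimes>\<^bsub>R\<^esub> u i), k' (v i)))"
      by (simp add: \<sigma>_def sum_subtractf)
    also have "\<dots> = (\<Sum>i<n. frag_of (f' (z \<otimes>\<^bsub>R\<^esub> u i) \<oplus>\<^bsub>M\<^esub> f' (z' \<otimes>\<^bsub>R\<^esub> u i), k' (v i))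
        - frag_of (f' (z \<otimes>\<^bsub>R\<^esub> u i), k' (v i)) - frag_of (f' (z' \<otimes>\<^bsub>R\<^esub> u i), k' (v i)))"
      using z zc uc zu by (intro sum.cong refl) (simp add: R.l_distr f'D(2))
    also have "\<dots> \<in> tensor_relations Re M N"
      using z zu v by (intro K_sum relations_in_K f'D(1) k'D(1)) auto
    finally show "\<sigma> (z \<oplus>\<^bsub>bimodule_in R (A (g \<otimes> h))\<^esub> z') - \<sigma> z - \<sigma> z' \<in> tensor_relations Re M N"
      by simp
  next
    fix x y assume x: "x \<in> carrier M" and y: "y \<in> carrier N"
    define a where "a i = k y \<otimes>\<^bsub>R\<^esub> u i" for i
    have a: "a i \<in> A \<one>" if "i < n" for i
      using component_mult_closed[OF h _ kD(1)[OF y] u[OF that]] h by (simp add: a_def)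
    have av: "a i \<otimes>\<^bsub>R\<^esub> v i \<in> A h" if "i < n" for i
      using component_mult_closed[OF G.one_closed h a[OF that] v[OF that]] h by simp
    \<comment> \<open>The second entries can be collected, because \<open>w \<mapsto> (x, k' w)\<close> is additive modulo the
      relations.\<close>
    have collect: "(\<Oplus>\<^bsub>R\<^esub>i\<in>{..<m}. a i \<otimes>\<^bsub>R\<^esub> v i) \<in> A h \<and>
        (\<Sum>i<m. frag_of (x, k' (a i \<otimes>\<^bsub>R\<^esub> v i))) -
          frag_of (x, k' (\<Oplus>\<^bsub>R\<^esub>i\<in>{..<m}. a i \<otimes>\<^bsub>R\<^esub> v i)) \<in> tensor_relations Re M N"
      if "m \<le> n" for m
      using that
    proof (induction m)
      case 0
      have "k' \<zero>\<^bsub>R\<^esub> = k' \<zero>\<^bsub>R\<^esub> \<oplus>\<^bsub>N\<^esub> k' \<zero>\<^bsub>R\<^esub>"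
        using k'D(2)[of "\<zero>\<^bsub>R\<^esub>" "\<zero>\<^bsub>R\<^esub>"] component_closed(2)[OF h] by simp
      then have "- frag_of (x, k' \<zero>\<^bsub>R\<^esub>) \<in> tensor_relations Re M N"
        using relations_in_K(2)[OF x k'D(1) k'D(1), of "\<zero>\<^bsub>R\<^esub>" "\<zero>\<^bsub>R\<^esub>"] component_closed(2)[OF h]
        by simp
      then show ?case
        by (simp add: component_closed(2)[OF h])
    next
      case (Suc m)
      let ?s = "\<lambda>m. \<Oplus>\<^bsub>R\<^esub>i\<in>{..<m}. a i \<otimes>\<^bsub>R\<^esub> v i" and ?w = "a m \<otimes>\<^bsub>R\<^esub> v m"
      have IH: "?s m \<in> A h"
        "(\<Sum>i<m. frag_of (x, k' (a i \<otimes>\<^bsub>R\<^esub> v i))) - frag_of (x, k' (?s m)) \<in> tensor_relations Re M N"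
        using Suc by auto
      have w: "?w \<in> A h"
        using Suc.prems av by simp
      have s: "?s (Suc m) = ?w \<oplus>\<^bsub>R\<^esub> ?s m"
        unfolding lessThan_Suc using Suc.prems av component_in_carrier[OF h]
        by (intro R.finsum_insert) auto
      have "frag_of (x, k' ?w \<oplus>\<^bsub>N\<^esub> k' (?s m)) - frag_of (x, k' ?w) - frag_of (x, k' (?s m))
          \<in> tensor_relations Re M N"
        using IH w by (intro relations_in_K x k'D(1))
      with IH(2) have "(\<Sum>i<m. frag_of (x, k' (a i \<otimes>\<^bsub>R\<^esub> v i))) - frag_of (x, k' (?s m)) -
          (frag_of (x, k' ?w \<oplus>\<^bsub>N\<^esub> k' (?s m)) - frag_of (x, k' ?w) - frag_of (x, k' (?s m)))
          \<in> tensor_relations Re M N"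
        by (rule K_closed(4))
      also have "(\<Sum>i<m. frag_of (x, k' (a i \<otimes>\<^bsub>R\<^esub> v i))) - frag_of (x, k' (?s m)) -
          (frag_of (x, k' ?w \<oplus>\<^bsub>N\<^esub> k' (?s m)) - frag_of (x, k' ?w) - frag_of (x, k' (?s m))) =
          (\<Sum>i<Suc m. frag_of (x, k' (a i \<otimes>\<^bsub>R\<^esub> v i))) - frag_of (x, k' (?s (Suc m)))"
        unfolding s k'D(2)[OF w IH(1)] by (simp add: algebra_simps)
      finally show ?case
        using s w IH(1) component_closed(3)[OF h] by simp
    qed
    have "\<sigma> (f x \<otimes>\<^bsub>R\<^esub> k y) = (\<Sum>i<n. frag_of (x \<odot>\<^sub>r\<^bsub>M\<^esub> a i, k' (v i)))"
      unfolding \<sigma>_def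
    proof (intro sum.cong refl)
      fix i assume "i \<in> {..<n}"
      then have i: "i < n"
        by simp
      have "f x \<otimes>\<^bsub>R\<^esub> k y \<otimes>\<^bsub>R\<^esub> u i = f (x \<odot>\<^sub>r\<^bsub>M\<^esub> a i)"
        using fD(4)[OF a[OF i] x] x y uc[OF i] by (simp add: a_def fc kc R.m_assoc)
      then show "frag_of (f' (f x \<otimes>\<^bsub>R\<^esub> k y \<otimes>\<^bsub>R\<^esub> u i), k' (v i)) = frag_of (x \<odot>\<^sub>r\<^bsub>M\<^esub> a i, k' (v i))"
        using f'f M.rsmult_closed[of "a i" x] a[OF i] x by simp
    qed
    moreover have "(\<Sum>i<n. frag_of (x \<odot>\<^sub>r\<^bsub>M\<^esub> a i, k' (v i)) - frag_of (x, a i \<odot>\<^bsub>N\<^esub> k' (v i)))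
        \<in> tensor_relations Re M N"
      using a v x by (intro K_sum relations_in_K k'D(1)) auto
    moreover have "(\<Sum>i<n. frag_of (x, a i \<odot>\<^bsub>N\<^esub> k' (v i))) = (\<Sum>i<n. frag_of (x, k' (a i \<otimes>\<^bsub>R\<^esub> v i)))"
      using a v by (intro sum.cong refl) (simp add: k'D(3))
    ultimately have "\<sigma> (f x \<otimes>\<^bsub>R\<^esub> k y) - (\<Sum>i<n. frag_of (x, k' (a i \<otimes>\<^bsub>R\<^esub> v i))) \<in> tensor_relations Re M N"
      by (simp add: sum_subtractf)
    moreover have "(\<Sum>i<n. frag_of (x, k' (a i \<otimes>\<^bsub>R\<^esub> v i))) - frag_of (x, y) \<in> tensor_relations Re M N"
      using collect[of n] split[OF kc[OF y]] k'k[OF y] by (simp flip: a_def)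
    ultimately have "\<sigma> (f x \<otimes>\<^bsub>R\<^esub> k y) - (\<Sum>i<n. frag_of (x, k' (a i \<otimes>\<^bsub>R\<^esub> v i))) +
        ((\<Sum>i<n. frag_of (x, k' (a i \<otimes>\<^bsub>R\<^esub> v i))) - frag_of (x, y)) \<in> tensor_relations Re M N"
      by (rule K_closed(2))
    then show "\<sigma> (f x \<otimes>\<^bsub>R\<^esub> k y) - frag_of (x, y) \<in> tensor_relations Re M N"
      by simp
  next
    fix z assume "z \<in> carrier (bimodule_in R (A (g \<otimes> h)))"
    then have z: "z \<in> A (g \<otimes> h)"
      by simp
    let ?x = "\<lambda>i. f' (z \<otimes>\<^bsub>R\<^esub> u i)" and ?y = "\<lambda>i. k' (v i)"
    have xy: "f (?x i) \<otimes>\<^bsub>R\<^esub> k (?y i) = z \<otimes>\<^bsub>R\<^esub> u i \<otimes>\<^bsub>R\<^esub> v i" if "i < n" for i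
      using that z zu v by (simp add: ff' kk')
    have "z = (\<Oplus>\<^bsub>R\<^esub>i\<in>{..<n}. z \<otimes>\<^bsub>R\<^esub> u i \<otimes>\<^bsub>R\<^esub> v i)"
      using z component_in_carrier[OF gh] by (intro split)
    also have "\<dots> = (\<Oplus>\<^bsub>R\<^esub>i\<in>{..<n}. f (?x i) \<otimes>\<^bsub>R\<^esub> k (?y i))"
      using z component_in_carrier[OF gh] uc vc by (intro R.finsum_cong') (auto simp: xy)
    also have "\<dots> = (\<Oplus>\<^bsub>bimodule_in R (A (g \<otimes> h))\<^esub>i\<in>{..<n}. f (?x i) \<otimes>\<^bsub>R\<^esub> k (?y i))"
      using z zu v fD(1) kD(1) f'D(1) k'D(1)
      by (intro finsum_bimodule_in[OF component_stable[OF gh], symmetric])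
         (auto intro!: component_mult_closed[OF g h])
    finally have "z = (\<Oplus>\<^bsub>bimodule_in R (A (g \<otimes> h))\<^esub>i\<in>{..<n}. f (?x i) \<otimes>\<^bsub>R\<^esub> k (?y i))" .
    moreover have "?x \<in> {..<n} \<rightarrow> carrier M" "?y \<in> {..<n} \<rightarrow> carrier N"
      using z zu v f'D(1) k'D(1) by auto
    ultimately show "\<exists>(n :: nat) x y. x \<in> {..<n} \<rightarrow> carrier M \<and> y \<in> {..<n} \<rightarrow> carrier N \<and>
        z = (\<Oplus>\<^bsub>bimodule_in R (A (g \<otimes> h))\<^esub>i\<in>{..<n}. f (x i) \<otimes>\<^bsub>R\<^esub> k (y i))"
      by (intro exI[of _ n] exI[of _ ?x] exI[of _ ?y]) simp
  qed
qed

lemma component_bimodule: "g \<in> carrier G \<Longrightarrow> bimodule Re (bimodule_in R (A g))"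
  using component_stable bimodule_in_iff component_closed(1) by blast

text \<open>The component of degree \<open>g\<inverse>\<close> is the inverse of \<open>A g\<close> under the tensor product.\<close>

lemma component_invertible_copy:
  assumes "g \<in> carrier G"
  obtains L :: "('c, 'c list) bimodule"
  where "invertible_bimodule Re L" "bimodule_isomorphic Re L (bimodule_in R (A g))"
proof -
  obtain L L' :: "('c, 'c list) bimodule"
    where L: "bimodule Re L" "bimodule_isomorphic Re L (bimodule_in R (A g))"
      and L': "bimodule Re L'" "bimodule_isomorphic Re L' (bimodule_in R (A (inv g)))"
    using bimodule_list_copy[OF component_bimodule] assms G.inv_closed by metis
  have "bimodule_isomorphic Re (tensor Re L L') (ring_bimodule Re)"
    "bimodule_isomorphic Re (tensor Re L' L) (ring_bimodule Re)"
    using tensor_components[OF L(1) L'(1) assms _ L(2) L'(2)]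
      tensor_components[OF L'(1) L(1) _ assms L'(2) L(2)] assms
    by (simp_all add: ring_bimodule_identity_component)
  then have "invertible_bimodule Re L"
    unfolding invertible_bimodule_def using L L' by blast
  then show ?thesis
    using L(2) by (rule that)
qed

lemma Pic_map_hom: "Pic_map G R A \<in> hom G (Pic Re)"
proof (rule homI)
  fix g assume g: "g \<in> carrier G"
  obtain L :: "('c, 'c list) bimodule"
    where L: "invertible_bimodule Re L" "bimodule_isomorphic Re L (bimodule_in R (A g))"
    using component_invertible_copy[OF g] .
  have "Pic_map G R A g = bimodule_class Re L"
    unfolding Pic_map_def
    using L by (intro bimodule_class_eqI) (auto simp: invertible_bimodule_def intro: bimodule_isomorphic_sym)
  then show "Pic_map G R A g \<in> carrier (Pic Re)"
    using L(1) by (auto simp: Pic_def)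
next
  fix g h assume g: "g \<in> carrier G" and h: "h \<in> carrier G"
  have "bimodule_class Re (tensor Re M N) = Pic_map G R A (g \<otimes> h)"
    if "M \<in> Pic_map G R A g" "N \<in> Pic_map G R A h" for M N
  proof -
    have "bimodule_isomorphic Re (tensor Re M N) (bimodule_in R (A (g \<otimes> h))) \<and>
        bimodule_isomorphic Re (bimodule_in R (A (g \<otimes> h))) (tensor Re M N)"
      using that g h by (intro tensor_components) (auto simp: Pic_map_def bimodule_class_def)
    then show ?thesis
      unfolding Pic_map_def by (intro bimodule_class_eqI) simp_all
  qed
  moreover have "Pic_map G R A g \<noteq> {}" if g: "g \<in> carrier G" for g
  proof -
    obtain L :: "('c, 'c list) bimodule"
      where L: "invertible_bimodule Re L" "bimodule_isomorphic Re L (bimodule_in R (A g))"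
      using component_invertible_copy[OF g] .
    then have "L \<in> Pic_map G R A g"
      by (simp add: Pic_map_def bimodule_class_def invertible_bimodule_def)
    then show ?thesis
      by blast
  qed
  ultimately have "(\<Union>M\<in>Pic_map G R A g. \<Union>N\<in>Pic_map G R A h. bimodule_class Re (tensor Re M N)) =
      Pic_map G R A (g \<otimes> h)"
    using g h by (simp cong: SUP_cong)
  then show "Pic_map G R A (g \<otimes> h) = Pic_map G R A g \<otimes>\<^bsub>Pic Re\<^esub> Pic_map G R A h"
    by (simp add: Pic_def)
qed

text \<open>Each class contains a copy of its component on the type of lists; this turns an equality of
  classes into an isomorphism of components.\<close>

lemma Pic_map_inj_iff: "inj_on (Pic_map G R A) (carrier G) \<longleftrightarrow> nonisomorphic_components"
proof -
  have "Pic_map G R A g = Pic_map G R A h \<longleftrightarrow> isomorphic_parts (A g) (A h)"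
    if g: "g \<in> carrier G" and h: "h \<in> carrier G" for g h
  proof
    assume eq: "Pic_map G R A g = Pic_map G R A h"
    obtain L :: "('c, 'c list) bimodule"
      where L: "invertible_bimodule Re L" "bimodule_isomorphic Re L (bimodule_in R (A g))"
      using component_invertible_copy[OF g] .
    then have "bimodule Re L"
      by (simp add: invertible_bimodule_def)
    with L(2) have "L \<in> Pic_map G R A g"
      by (simp add: Pic_map_def bimodule_class_def)
    then have "L \<in> Pic_map G R A h"
      unfolding eq .
    then have "bimodule_isomorphic Re L (bimodule_in R (A h))"
      by (simp add: Pic_map_def bimodule_class_def)
    with bimodule_isomorphic_sym[OF \<open>bimodule Re L\<close> L(2)] show "isomorphic_parts (A g) (A h)"
      by (rule bimodule_isomorphic_trans)
  next
    assume iso: "isomorphic_parts (A g) (A h)"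
    show "Pic_map G R A g = Pic_map G R A h"
      unfolding Pic_map_def
      by (rule bimodule_class_eqI[OF iso bimodule_isomorphic_sym[OF component_bimodule[OF g] iso]])
  qed
  then show ?thesis
    unfolding inj_on_def nonisomorphic_components_def by blast
qed

end

section \<open>The equivalences\<close>

theorem theorem4p5:
  fixes G :: "('g, 'b) monoid_scheme"
    and R :: "('r, 'c) ring_scheme"
    and A :: "'g \<Rightarrow> 'r set"
  assumes "strongly_graded_ring G R A"
  shows
    "(controlled G R A \<longleftrightarrow>
       (\<forall>g \<in> carrier G. simple_bimodule (identity_component G R A) (bimodule_in R (A g))) \<and>
       centralizer R (carrier (identity_component G R A)) = center (identity_component G R A)) \<and>
     (controlled G R A \<longleftrightarrow>
       (\<forall>g \<in> carrier G. simple_bimodule (identity_component G R A) (bimodule_in R (A g))) \<and>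
       Pic_map G R A \<in> hom G (Pic (identity_component G R A)) \<and>
       inj_on (Pic_map G R A) (carrier G))"
proof -
  interpret strongly_graded_ring G R A
    by fact
  have controlled: "controlled G R A \<longleftrightarrow> simple_components \<and> nonisomorphic_components"
    using controlledI controlled_simple_components controlled_nonisomorphic_components by blast
  have "centralizer R (A \<one>\<^bsub>G\<^esub>) = center Re \<longleftrightarrow> nonisomorphic_components" if simple_components
    using that centralizer_eq_center isomorphic_components_eq
    unfolding nonisomorphic_components_def by blast
  then show ?thesis
    using controlled Pic_map_hom Pic_map_inj_iff by (auto simp: simple_components_def)
qed

end
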